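(* Let $(\Omega,\mathcal{A},T,\mu,\mathcal{F},\|\cdot\|,\chi)$ fulfill Property $\mathfrak{D}$, and assume that $\mu(\chi>x)=L(x)/x^{\alpha}$ (for $x>0$), where $L$ is a slowly varying function and $0<\alpha<1$. Let $(b_n)_{n\in\mathbb{N}}$ be a sequence of natural numbers tending to infinity such that $b_n=o(n)$. Assume that at least one $\psi$-mixing coefficient of the sequence of random variables $(\chi\circ T^{n-1})_{n\in\mathbb{N}}$ is strictly less than one, i.e. $\psi(r)<1$ for some $r\in\mathbb{N}$. Define $$d_n:=\frac{\alpha}{1-\alpha}\cdot n^{1/\alpha}\cdot b_n^{1-1/\alpha}\cdot\left(L^{-1/\alpha}\right)^{\#}\left(\left(\frac{n}{b_n}\right)^{1/\alpha}\right).$$ Then $$\lim_{n\to\infty}\int\left|\frac{\mathsf{S}_n^{b_n}\chi}{d_n}-1\right|\,\mathrm{d}\mu=0 .$$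
   Context: Here $\mathbb{N}=\{1,2,\dots\}$. **Spectral gap.** A bounded linear operator $U:\mathcal{F}\to\mathcal{F}$ on a Banach space has a spectral gap if $U=\lambda P+N$ with $\lambda\in\mathbb{C}$ and $P,N$ bounded linear operators such that $P^2=P$ has one-dimensional image, the spectral radius of $N$ satisfies $\rho(N)<|\lambda|$, and $PN=NP=0$. **Property $\mathfrak{C}$.** Let $(\Omega,\mathcal{A},T,\mu)$ be a dynamical system with $T$ a non-singular transformation, and let $\widehat{T}:\mathcal{L}^1\to\mathcal{L}^1$ be its transfer operator, i.e. the unique operator with $\int\widehat{T}f\cdot g\,\mathrm{d}\mu=\int f\cdot g\circ T\,\mathrm{d}\mu$ for all $f\in\mathcal{L}^1$, $g\in\mathcal{L}^\infty$. Let $\mathcal{F}$ be a subset of the measurable functions forming a Banach algebra with respect to the norm $\|\cdot\|$. Then $(\Omega,\mathcal{A},T,\mu,\mathcal{F},\|\cdot\|)$ has Property $\mathfrak{C}$ if: (1) $\mu$ is a $T$-invariant, mixing probability measure; (2) $\mathcal{F}$ contains the constant functions and $\|f\|\ge|f|_\infty$ for all $f\in\mathcal{F}$; (3) there is a constant $K_0>0$ with $\|\widehat{T}f\|\le K_0\|f\|$ for all $f\in\mathcal{F}$; (4) $\widehat{T}$ acting on $(\mathcal{F},\|\cdot\|)$ has a spectral gap. **Property $\mathfrak{D}$.** $(\Omega,\mathcal{A},T,\mu,\mathcal{F},\|\cdot\|,\chi)$ has Property $\mathfrak{D}$ if $(\Omega,\mathcal{A},T,\mu,\mathcal{F},\|\cdot\|)$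 has Property $\mathfrak{C}$, $\chi:\Omega\to\mathbb{R}_{\ge0}$ is $\mathcal{A}$-measurable, and there is $K_1>0$ such that for all $\ell\in\mathbb{R}_{\ge0}$: $\|\chi\cdot\mathbf{1}_{\{\chi\le\ell\}}\|\le K_1\ell$ and $\|\mathbf{1}_{\{\chi>\ell\}}\|\le K_1$ (in particular, these functions belong to $\mathcal{F}$). **Trimmed sums.** For $n\in\mathbb{N}$ and $b\in\mathbb{N}_0$, $\mathsf{S}_n^{b}\chi$ is the sum of the $n$ values $\chi,\chi\circ T,\dots,\chi\circ T^{n-1}$ with the $b$ largest of them removed: pointwise, if $\chi\circ T^{\sigma(1)}\ge\dots\ge\chi\circ T^{\sigma(n)}$ is a decreasing ordering, where $\sigma:\{1,\dots,n\}\to\{0,\dots,n-1\}$ is a (point-dependent) bijection, then $\mathsf{S}_n^b\chi=\sum_{k=b+1}^{n}\chi\circ T^{\sigma(k)}$ (an empty sum is $0$). **Slow variation and de Bruijn conjugate.** $L$ is slowly varying if $\lim_{x\to\infty}L(cx)/L(x)=1$ for every $c>0$. For a slowly varying function $\ell$, $\ell^{\#}$ denotes a de Bruijn conjugate of $\ell$, i.e. a slowly varying function with $\lim_{x\to\infty}\ell(x)\,\ell^{\#}(x\ell(x))=1=\lim_{x\to\infty}\ell^{\#}(x)\,\ell(x\ell^{\#}(x))$ (it is unique up to asymptotic equivalence); $L^{-1/\alpha}$ denotes the function $x\mapsto L(x)^{-1/\alpha}$. **$\psi$-mixing coefficients.** For sub-$\sigma$-fields $\mathcal{B},\mathcal{C}$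 of a probability space with measure $\mathbb{P}$, $\psi(\mathcal{B},\mathcal{C}):=\sup\left\{\left|\frac{\mathbb{P}(B\cap C)}{\mathbb{P}(B)\mathbb{P}(C)}-1\right|: B\in\mathcal{B},\,C\in\mathcal{C},\,\mathbb{P}(B),\mathbb{P}(C)>0\right\}$. For a sequence $(X_n)_{n\in\mathbb{N}}$ of random variables, $\psi(n):=\sup_{k\in\mathbb{N}}\psi\big(\sigma(X_j:1\le j\le k),\,\sigma(X_j:j\ge k+n)\big)$. Here $\mathbb{P}=\mu$ and $X_n=\chi\circ T^{n-1}$. *)

theory Defs
  imports "HOL-Probability.Probability" "HOL-Library.Landau_Symbols"
begin

section \<open>Spaces of measurable functions and their operators\<close>

text \<open>A space of measurable functions modulo almost everywhere equality is represented by a set F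
  of complex functions that is closed under almost everywhere equality. The norm is a function of
  the representative that only depends on the class, and equality in the space is AE equality.\<close>

definition function_banach_algebra ::
    "'a measure \<Rightarrow> ('a \<Rightarrow> complex) set \<Rightarrow> (('a \<Rightarrow> complex) \<Rightarrow> real) \<Rightarrow> bool" where
  "function_banach_algebra M F nrm \<longleftrightarrow>
     F \<subseteq> borel_measurable M \<and>
     (\<forall>f\<in>F. \<forall>g\<in>borel_measurable M. (AE x in M. f x = g x) \<longrightarrow> g \<in> F \<and> nrm g = nrm f) \<and>
     (\<lambda>x. 0) \<in> F \<and>
     (\<forall>f\<in>F. \<forall>g\<in>F. (\<lambda>x. f x + g x) \<in> F) \<and>
     (\<forall>c. \<forall>f\<in>F. (\<lambda>x. c * f x) \<in> F) \<and>
     (\<forall>f\<in>F. \<forall>g\<in>F. (\<lambda>x. f x * g x) \<in> F) \<and>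
     (\<forall>f\<in>F. 0 \<le> nrm f) \<and>
     (\<forall>f\<in>F. nrm f = 0 \<longleftrightarrow> (AE x in M. f x = 0)) \<and>
     (\<forall>f\<in>F. \<forall>g\<in>F. nrm (\<lambda>x. f x + g x) \<le> nrm f + nrm g) \<and>
     (\<forall>c. \<forall>f\<in>F. nrm (\<lambda>x. c * f x) = cmod c * nrm f) \<and>
     (\<forall>f\<in>F. \<forall>g\<in>F. nrm (\<lambda>x. f x * g x) \<le> nrm f * nrm g) \<and>
     (\<forall>u :: nat \<Rightarrow> 'a \<Rightarrow> complex. (\<forall>n. u n \<in> F) \<longrightarrow>
        (\<forall>e>0. \<exists>N. \<forall>m\<ge>N. \<forall>n\<ge>N. nrm (\<lambda>x. u m x - u n x) < e) \<longrightarrow>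
        (\<exists>f\<in>F. (\<lambda>n. nrm (\<lambda>x. u n x - f x)) \<longlonglongrightarrow> 0))"

text \<open>Linearity and the bound together imply that such an operator respects AE equality.\<close>

definition bounded_linear_op ::
    "'a measure \<Rightarrow> ('a \<Rightarrow> complex) set \<Rightarrow> (('a \<Rightarrow> complex) \<Rightarrow> real) \<Rightarrow>
     (('a \<Rightarrow> complex) \<Rightarrow> 'a \<Rightarrow> complex) \<Rightarrow> bool" where
  "bounded_linear_op M F nrm U \<longleftrightarrow>
     (\<forall>f\<in>F. U f \<in> F) \<and>
     (\<forall>f\<in>F. \<forall>g\<in>F. AE x in M. U (\<lambda>y. f y + g y) x = U f x + U g x) \<and>
     (\<forall>c. \<forall>f\<in>F. AE x in M. U (\<lambda>y. c * f y) x = c * U f x) \<and>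
     (\<exists>K. \<forall>f\<in>F. nrm (U f) \<le> K * nrm f)"

definition op_spectrum ::
    "'a measure \<Rightarrow> ('a \<Rightarrow> complex) set \<Rightarrow> (('a \<Rightarrow> complex) \<Rightarrow> real) \<Rightarrow>
     (('a \<Rightarrow> complex) \<Rightarrow> 'a \<Rightarrow> complex) \<Rightarrow> complex set" where
  "op_spectrum M F nrm U = {z. \<not> (\<exists>R. bounded_linear_op M F nrm R \<and>
     (\<forall>f\<in>F. (AE x in M. R (\<lambda>y. z * f y - U f y) x = f x) \<and>
             (AE x in M. z * R f x - U (R f) x = f x)))}"

definition op_spectral_radius ::
    "'a measure \<Rightarrow> ('a \<Rightarrow> complex) set \<Rightarrow> (('a \<Rightarrow> complex) \<Rightarrow> real) \<Rightarrow>
     (('a \<Rightarrow> complex) \<Rightarrow> 'a \<Rightarrow> complex) \<Rightarrow> real" where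
  "op_spectral_radius M F nrm U = Sup (cmod ` op_spectrum M F nrm U)"

definition has_spectral_gap ::
    "'a measure \<Rightarrow> ('a \<Rightarrow> complex) set \<Rightarrow> (('a \<Rightarrow> complex) \<Rightarrow> real) \<Rightarrow>
     (('a \<Rightarrow> complex) \<Rightarrow> 'a \<Rightarrow> complex) \<Rightarrow> bool" where
  "has_spectral_gap M F nrm U \<longleftrightarrow> bounded_linear_op M F nrm U \<and>
     (\<exists>l P N. bounded_linear_op M F nrm P \<and> bounded_linear_op M F nrm N \<and>
        (\<forall>f\<in>F. AE x in M. U f x = l * P f x + N f x) \<and>
        (\<forall>f\<in>F. AE x in M. P (P f) x = P f x) \<and>
        (\<exists>e\<in>F. \<not> (AE x in M. e x = 0) \<and> (\<exists>f\<in>F. AE x in M. P f x = e x) \<and>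
                (\<forall>f\<in>F. \<exists>c. AE x in M. P f x = c * e x)) \<and>
        op_spectral_radius M F nrm N < cmod l \<and>
        (\<forall>f\<in>F. AE x in M. P (N f) x = 0) \<and>
        (\<forall>f\<in>F. AE x in M. N (P f) x = 0))"


section \<open>The dynamical system\<close>

definition nonsingular_map :: "'a measure \<Rightarrow> ('a \<Rightarrow> 'a) \<Rightarrow> bool" where
  "nonsingular_map M T \<longleftrightarrow> T \<in> measurable M M \<and>
     (\<forall>A\<in>sets M. emeasure M (T -` A \<inter> space M) = 0 \<longleftrightarrow> emeasure M A = 0)"

definition mixing :: "'a measure \<Rightarrow> ('a \<Rightarrow> 'a) \<Rightarrow> bool" where
  "mixing M T \<longleftrightarrow> (\<forall>A\<in>sets M. \<forall>B\<in>sets M.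
     (\<lambda>n. measure M (A \<inter> ((T ^^ n) -` B \<inter> space M))) \<longlonglongrightarrow> measure M A * measure M B)"

text \<open>For integrable f and non-singular T a suitable g exists and is unique up to AE equality.\<close>

definition transfer_operator ::
    "'a measure \<Rightarrow> ('a \<Rightarrow> 'a) \<Rightarrow> ('a \<Rightarrow> complex) \<Rightarrow> 'a \<Rightarrow> complex" where
  "transfer_operator M T f = (SOME g. integrable M g \<and>
     (\<forall>h\<in>borel_measurable M. (\<exists>C. AE x in M. cmod (h x) \<le> C) \<longrightarrow>
        (\<integral>x. g x * h x \<partial>M) = (\<integral>x. f x * h (T x) \<partial>M)))"

definition property_C ::
    "'a measure \<Rightarrow> ('a \<Rightarrow> 'a) \<Rightarrow> ('a \<Rightarrow> complex) set \<Rightarrow> (('a \<Rightarrow> complex) \<Rightarrow> real) \<Rightarrow> bool" where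
  "property_C M T F nrm \<longleftrightarrow>
     nonsingular_map M T \<and> function_banach_algebra M F nrm \<and>
     prob_space M \<and> distr M M T = M \<and> mixing M T \<and>
     (\<forall>c. (\<lambda>x. c) \<in> F) \<and>
     (\<forall>f\<in>F. esssup M (\<lambda>x. ereal (cmod (f x))) \<le> ereal (nrm f)) \<and>
     (\<exists>K0>0. \<forall>f\<in>F. transfer_operator M T f \<in> F \<and> nrm (transfer_operator M T f) \<le> K0 * nrm f) \<and>
     has_spectral_gap M F nrm (transfer_operator M T)"

definition property_D ::
    "'a measure \<Rightarrow> ('a \<Rightarrow> 'a) \<Rightarrow> ('a \<Rightarrow> complex) set \<Rightarrow> (('a \<Rightarrow> complex) \<Rightarrow> real) \<Rightarrow>
     ('a \<Rightarrow> real) \<Rightarrow> bool" where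
  "property_D M T F nrm chi \<longleftrightarrow>
     property_C M T F nrm \<and>
     chi \<in> borel_measurable M \<and> (\<forall>x\<in>space M. 0 \<le> chi x) \<and>
     (\<exists>K1>0. \<forall>l\<ge>0.
        (\<lambda>x. complex_of_real (chi x * indicator {y. chi y \<le> l} x)) \<in> F \<and>
        nrm (\<lambda>x. complex_of_real (chi x * indicator {y. chi y \<le> l} x)) \<le> K1 * l \<and>
        (\<lambda>x. complex_of_real (indicator {y. chi y > l} x)) \<in> F \<and>
        nrm (\<lambda>x. complex_of_real (indicator {y. chi y > l} x)) \<le> K1)"

definition trimmed_sum :: "('a \<Rightarrow> 'a) \<Rightarrow> ('a \<Rightarrow> real) \<Rightarrow> nat \<Rightarrow> nat \<Rightarrow> 'a \<Rightarrow> real" where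
  "trimmed_sum T chi n b x = sum_list (drop b (rev (sort (map (\<lambda>k. chi ((T ^^ k) x)) [0..<n]))))"


section \<open>Slow variation\<close>

text \<open>As usual in the theory of regular variation, slowly varying functions are (eventually) positive.\<close>

definition slowly_varying :: "(real \<Rightarrow> real) \<Rightarrow> bool" where
  "slowly_varying L \<longleftrightarrow> (\<forall>\<^sub>F x in at_top. L x > 0) \<and>
     (\<forall>c>0. ((\<lambda>x. L (c * x) / L x) \<longlongrightarrow> 1) at_top)"

definition de_Bruijn_conjugate :: "(real \<Rightarrow> real) \<Rightarrow> (real \<Rightarrow> real) \<Rightarrow> bool" where
  "de_Bruijn_conjugate l l' \<longleftrightarrow> slowly_varying l' \<and>
     ((\<lambda>x. l x * l' (x * l x)) \<longlongrightarrow> 1) at_top \<and>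
     ((\<lambda>x. l' x * l (x * l' x)) \<longlongrightarrow> 1) at_top"


section \<open>Psi-mixing coefficients\<close>

text \<open>The coefficients take values in the extended reals, as the suprema may be infinite.\<close>

definition psi_dependence :: "'a measure \<Rightarrow> 'a set set \<Rightarrow> 'a set set \<Rightarrow> ereal" where
  "psi_dependence M \<B> \<C> =
     (SUP (B, C) \<in> {(B, C). B \<in> \<B> \<and> C \<in> \<C> \<and> measure M B > 0 \<and> measure M C > 0}.
        ereal \<bar>measure M (B \<inter> C) / (measure M B * measure M C) - 1\<bar>)"

definition generated_sigma_field ::
    "'a measure \<Rightarrow> (nat \<Rightarrow> 'a \<Rightarrow> real) \<Rightarrow> nat set \<Rightarrow> 'a set set" where
  "generated_sigma_field M X J =
     sigma_sets (space M) (\<Union>j\<in>J. {X j -` A \<inter> space M | A. A \<in> sets borel})"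

text \<open>The sequence X is indexed from 1; its value at 0 plays no role.\<close>

definition psi_mixing_coeff :: "'a measure \<Rightarrow> (nat \<Rightarrow> 'a \<Rightarrow> real) \<Rightarrow> nat \<Rightarrow> ereal" where
  "psi_mixing_coeff M X n =
     (SUP k\<in>{1..}. psi_dependence M (generated_sigma_field M X {1..k})
                                     (generated_sigma_field M X {k + n..}))"

end

theory Submission
  imports Defs
begin

text \<open>
  Write \<open>Gbar u = \<mu>(\<chi> > u)\<close> for the tail, \<open>N\<^sub>n(u)\<close> for the number of \<open>k < n\<close> with \<open>\<chi> (T\<^sup>k x) > u\<close>, and
  \<open>l\<^sub>n = y L\<^sup>#(y)\<close> with \<open>y = (n/b\<^sub>n)\<^sup>1\<^sup>/\<^sup>\<alpha>\<close>, so that \<open>d\<^sub>n = \<alpha>/(1-\<alpha>) b\<^sub>n l\<^sub>n\<close>. The conjugate is exactly what makes \<open>l\<^sub>n\<close> an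
  asymptotic quantile: \<open>l\<^sub>n \<rightarrow> \<infinity>\<close> and \<open>(n/b\<^sub>n) Gbar(l\<^sub>n) \<rightarrow> 1\<close> (lemma \<open>de_Bruijn_quantile\<close>).

  Removing the \<open>b\<close> largest values turns the layer cake formula for the sum into
  \<open>S\<^sub>n\<^sup>b \<chi> = \<integral>\<^sub>0\<^sup>\<infinity> max 0 (N\<^sub>n(u) - b) du\<close> (lemma \<open>trimmed_sum_layer_cake\<close>). Substituting \<open>u = l\<^sub>n v\<close>,
  \<open>S\<^sub>n\<^sup>b \<chi> / (b\<^sub>n l\<^sub>n)\<close> is the integral of \<open>max 0 (N\<^sub>n(l\<^sub>n v)/b\<^sub>n - 1)\<close> over \<open>v > 0\<close>. The mean of \<open>N\<^sub>n(l\<^sub>n v)/b\<^sub>n\<close> is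
  \<open>(n/b\<^sub>n) Gbar(l\<^sub>n v)\<close>, which tends to \<open>v\<^sup>-\<^sup>\<alpha>\<close>, and \<open>\<integral>\<^sub>0\<^sup>\<infinity> max 0 (v\<^sup>-\<^sup>\<alpha> - 1) dv = \<alpha>/(1-\<alpha>)\<close>. By Tonelli's theorem the
  \<open>L\<^sup>1\<close> distance is therefore at most the integral over \<open>v\<close> of the mean distance of the two integrands, and
  one application of dominated convergence in \<open>v\<close> remains (lemma \<open>trimmed_sum_L1_limit\<close>). It needs two
  probabilistic inputs.

  For pointwise convergence the count must concentrate, which follows from a variance of order
  \<open>n Gbar(u)\<close>, uniformly in \<open>u\<close> (lemma \<open>count_mean_deviation\<close>). This uses the spectral gap, but only through Poisson's
  equation: for \<open>f\<close> in the algebra, \<open>f - \<integral>f = h - T_hat h\<close> has a solution with \<open>\<parallel>h\<parallel> \<le> C \<parallel>f\<parallel>\<close>, since \<open>1\<close> is not in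
  the spectrum of the remainder \<open>N\<close> in the decomposition \<open>T_hat = P + N\<close> (lemma \<open>poisson_equation\<close>). By duality the correlations of \<open>f\<close> then telescope, so that their sums are bounded by
  \<open>\<parallel>f\<parallel>\<close> times an \<open>L\<^sup>1\<close> norm (lemma \<open>summed_correlations\<close>). For \<open>f\<close> the indicator of \<open>{\<chi> > u}\<close> the norms are bounded in \<open>u\<close>.

  For the majorant, the mean count and a Potter bound with an exponent in \<open>(\<alpha>, 1)\<close> suffice when \<open>v \<le> 1\<close>. When \<open>v > 1\<close>
  the tail itself is not integrable, as \<open>\<alpha> < 1\<close>, and the variance bound decays no faster. Here \<open>\<psi>(r) < 1\<close>
  gives \<open>\<mu>(A \<inter> B) \<le> 2 \<mu>(A) \<mu>(B)\<close> for events separated by a gap \<open>r\<close>, hence factorial moments of every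
  order \<open>p\<close> for the counts along residue classes modulo \<open>r\<close>, and the mean of \<open>max 0 (N\<^sub>n/b - 1)\<close> is at most a
  constant times \<open>(n Gbar/b)\<^sup>p\<close> (lemma \<open>expectation_excess_le\<close>). Large \<open>p\<close> makes this integrable.
\<close>

section \<open>Bounded operators on a space of measurable functions\<close>

locale function_algebra =
  fixes M :: "'a measure" and F :: "('a \<Rightarrow> complex) set" and nrm :: "('a \<Rightarrow> complex) \<Rightarrow> real"
  assumes fba: "function_banach_algebra M F nrm"
begin

lemmas fba_unfolded = fba[unfolded function_banach_algebra_def]

lemma meas: "f \<in> F \<Longrightarrow> f \<in> borel_measurable M"
  by (rule subsetD[OF conjunct1[OF fba_unfolded]])

lemma AE_closed:
  assumes "f \<in> F" "g \<in> borel_measurable M" "AE x in M. f x = g x"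
  shows "g \<in> F" "nrm g = nrm f"
proof -
  from fba_unfolded
  have "\<forall>f\<in>F. \<forall>g\<in>borel_measurable M. (AE x in M. f x = g x) \<longrightarrow> g \<in> F \<and> nrm g = nrm f"
    by (elim conjE) assumption
  from this[rule_format, OF assms] show "g \<in> F" "nrm g = nrm f" by auto
qed

context begin

private lemmas r1 = fba_unfolded[THEN conjunct2, THEN conjunct2]
lemmas zero_mem = r1[THEN conjunct1]
private lemmas r2 = r1[THEN conjunct2]
lemmas add_mem = r2[THEN conjunct1, rule_format]
private lemmas r3 = r2[THEN conjunct2]
lemmas scale_mem = r3[THEN conjunct1, rule_format]
private lemmas r4 = r3[THEN conjunct2]
private lemmas r5 = r4[THEN conjunct2]
lemmas nrm_nonneg = r5[THEN conjunct1, rule_format]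
private lemmas r6 = r5[THEN conjunct2]
lemmas nrm_eq_0 = r6[THEN conjunct1, rule_format]
private lemmas r7 = r6[THEN conjunct2]
lemmas nrm_add = r7[THEN conjunct1, rule_format]
private lemmas r8 = r7[THEN conjunct2]
lemmas nrm_scale = r8[THEN conjunct1, rule_format]
private lemmas r9 = r8[THEN conjunct2]
private lemmas r10 = r9[THEN conjunct2]
lemmas cauchy_limit = r10[rule_format]

end

lemma diff_mem: "f \<in> F \<Longrightarrow> g \<in> F \<Longrightarrow> (\<lambda>x. f x - g x) \<in> F"
  using add_mem[of f "\<lambda>x. (-1) * g x"] scale_mem[of g "-1"] by simp

lemma nrm_diff: "f \<in> F \<Longrightarrow> g \<in> F \<Longrightarrow> nrm (\<lambda>x. f x - g x) \<le> nrm f + nrm g"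
  using nrm_add[of f "\<lambda>x. (-1) * g x"] scale_mem[of g "-1"] nrm_scale[of g "-1"] by simp

lemma op_mem: "bounded_linear_op M F nrm U \<Longrightarrow> f \<in> F \<Longrightarrow> U f \<in> F"
  and op_add: "bounded_linear_op M F nrm U \<Longrightarrow> f \<in> F \<Longrightarrow> g \<in> F \<Longrightarrow>
      AE x in M. U (\<lambda>y. f y + g y) x = U f x + U g x"
  and op_scale: "bounded_linear_op M F nrm U \<Longrightarrow> f \<in> F \<Longrightarrow>
      AE x in M. U (\<lambda>y. c * f y) x = c * U f x"
  by (simp_all add: bounded_linear_op_def)

lemma op_bound:
  assumes "bounded_linear_op M F nrm U"
  obtains K where "K \<ge> 0" "\<And>f. f \<in> F \<Longrightarrow> nrm (U f) \<le> K * nrm f"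
proof -
  obtain K where K: "\<forall>f\<in>F. nrm (U f) \<le> K * nrm f"
    using assms unfolding bounded_linear_op_def by blast
  show thesis
  proof (rule that[of "max K 0"])
    fix f assume f: "f \<in> F"
    have "K * nrm f \<le> max K 0 * nrm f"
      using nrm_nonneg[OF f] by (intro mult_right_mono) auto
    then show "nrm (U f) \<le> max K 0 * nrm f" using K f by force
  qed simp
qed

lemma op_diff:
  assumes "bounded_linear_op M F nrm U" "f \<in> F" "g \<in> F"
  shows "AE x in M. U (\<lambda>y. f y - g y) x = U f x - U g x"
  using op_add[OF assms(1,2) scale_mem[OF assms(3), of "-1"]] op_scale[OF assms(1,3), of "-1"]
  by eventually_elim simp

lemma op_zero:
  assumes "bounded_linear_op M F nrm U" "f \<in> F" "AE x in M. f x = 0"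
  shows "AE x in M. U f x = 0"
proof -
  obtain K where "nrm (U f) \<le> K * nrm f" using op_bound[OF assms(1)] assms(2) by metis
  moreover have "nrm f = 0" using assms nrm_eq_0 by blast
  ultimately have "nrm (U f) = 0" using nrm_nonneg[OF op_mem[OF assms(1,2)]] by simp
  then show ?thesis using nrm_eq_0 op_mem[OF assms(1,2)] by blast
qed

lemma op_cong:
  assumes "bounded_linear_op M F nrm U" "f \<in> F" "g \<in> F" "AE x in M. f x = g x"
  shows "AE x in M. U f x = U g x"
proof -
  have "AE x in M. U (\<lambda>y. f y - g y) x = 0"
    using op_zero[OF assms(1) diff_mem[OF assms(2,3)]] assms(4) by simp
  with op_diff[OF assms(1-3)] show ?thesis by eventually_elim simp
qed

lemma nrm_op_diff_le:
  assumes U: "bounded_linear_op M F nrm U" and K: "\<And>f. f \<in> F \<Longrightarrow> nrm (U f) \<le> K * nrm f"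
    and f: "f \<in> F" and g: "g \<in> F"
  shows "nrm (\<lambda>x. U f x - U g x) \<le> K * nrm (\<lambda>x. f x - g x)"
proof -
  have "nrm (\<lambda>x. U f x - U g x) = nrm (U (\<lambda>y. f y - g y))"
    using op_diff[OF U f g] meas[OF diff_mem[OF op_mem[OF U f] op_mem[OF U g]]]
    by (rule AE_closed(2)[OF op_mem[OF U diff_mem[OF f g]], rotated])
  then show ?thesis using K[OF diff_mem[OF f g]] by simp
qed

text \<open>Banach's fixed point theorem for \<open>g \<mapsto> (f + U g) / z\<close>, which is a contraction as soon as
  \<open>\<bar>z\<bar>\<close> exceeds the norm of \<open>U\<close>. The partial sums of the Neumann series are the iterates from \<open>0\<close>.\<close>

lemma neumann_solution:
  assumes U: "bounded_linear_op M F nrm U" and K: "\<And>f. f \<in> F \<Longrightarrow> nrm (U f) \<le> K * nrm f"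
    and "K \<ge> 0" "cmod z > K" and f: "f \<in> F"
  shows "\<exists>g\<in>F. AE x in M. z * g x - U g x = f x"
proof -
  have z0: "z \<noteq> 0" using assms(3,4) by auto
  define \<Phi> where "\<Phi> g = (\<lambda>x. (1/z) * (f x + U g x))" for g
  define q where "q = K / cmod z"
  have q: "0 \<le> q" "q < 1" using z0 assms(3,4) by (auto simp: q_def divide_simps)
  have \<Phi>_mem: "\<Phi> g \<in> F" if "g \<in> F" for g
    unfolding \<Phi>_def by (intro scale_mem add_mem f op_mem[OF U] that)
  have \<Phi>_contr: "nrm (\<lambda>x. \<Phi> g x - \<Phi> h x) \<le> q * nrm (\<lambda>x. g x - h x)" if "g \<in> F" "h \<in> F" for g h
  proof -
    have "(\<lambda>x. \<Phi> g x - \<Phi> h x) = (\<lambda>x. (1/z) * (U g x - U h x))"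
      by (auto simp: \<Phi>_def algebra_simps)
    then have "nrm (\<lambda>x. \<Phi> g x - \<Phi> h x) = cmod (1/z) * nrm (\<lambda>x. U g x - U h x)"
      using nrm_scale[OF diff_mem[OF op_mem[OF U that(1)] op_mem[OF U that(2)]], of "1/z"] by simp
    also have "\<dots> \<le> cmod (1/z) * (K * nrm (\<lambda>x. g x - h x))"
      by (intro mult_left_mono nrm_op_diff_le[OF U K] that) auto
    finally show ?thesis by (simp add: q_def norm_divide)
  qed
  define u where "u n = (\<Phi> ^^ n) (\<lambda>x. 0)" for n
  have u0: "u 0 = (\<lambda>x. 0)" and uSuc: "u (Suc n) = \<Phi> (u n)" for n by (auto simp: u_def)
  have u_mem: "u n \<in> F" for n by (induction n) (auto simp: u0 uSuc zero_mem \<Phi>_mem)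
  define B where "B = nrm (u 1) / (1 - q)"
  have B0: "B \<ge> 0" using nrm_nonneg[OF u_mem[of 1]] q by (simp add: B_def)
  have B: "nrm (u 1) + q * B = B" using q by (simp add: B_def field_simps)
  have bound: "nrm (u n) \<le> B" for n
  proof (induction n)
    case 0
    have "nrm (\<lambda>x. 0) = 0" using nrm_eq_0[OF zero_mem] by simp
    then show ?case using B0 by (simp add: u0)
  next
    case (Suc n)
    have "nrm (u (Suc n)) = nrm (\<lambda>x. u 1 x + (u (Suc n) x - u 1 x))" by simp
    also have "\<dots> \<le> nrm (u 1) + nrm (\<lambda>x. u (Suc n) x - u 1 x)"
      by (intro nrm_add u_mem diff_mem)
    also have "nrm (\<lambda>x. u (Suc n) x - u 1 x) \<le> q * nrm (\<lambda>x. u n x - u 0 x)"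
      using \<Phi>_contr[OF u_mem[of n] u_mem[of 0]] uSuc[of n] uSuc[of 0] by simp
    also have "\<dots> \<le> q * B" using Suc q by (intro mult_left_mono) (auto simp: u0)
    finally show ?case using B by simp
  qed
  have cauchy: "nrm (\<lambda>x. u (n + k) x - u n x) \<le> q ^ n * B" for n k
  proof (induction n)
    case 0
    then show ?case using bound by (simp add: u0)
  next
    case (Suc n)
    have "nrm (\<lambda>x. u (Suc n + k) x - u (Suc n) x) \<le> q * nrm (\<lambda>x. u (n + k) x - u n x)"
      using \<Phi>_contr[OF u_mem[of "n+k"] u_mem[of n]] by (simp add: uSuc)
    also have "\<dots> \<le> q * (q ^ n * B)" using Suc q by (intro mult_left_mono) auto
    finally show ?case by (simp add: mult.assoc)
  qed
  have small: "\<exists>N. \<forall>m\<ge>N. \<forall>n\<ge>N. nrm (\<lambda>x. u m x - u n x) < e" if "e > 0" for e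
  proof -
    have "(\<lambda>n. 2 * (q ^ n * B)) \<longlonglongrightarrow> 2 * (0 * B)"
      using q by (intro tendsto_intros LIMSEQ_realpow_zero) auto
    then have "eventually (\<lambda>n. 2 * (q ^ n * B) < e) sequentially"
      using that by (intro order_tendstoD(2)) auto
    then obtain N where N: "2 * (q ^ N * B) < e" by (auto simp: eventually_sequentially)
    have "nrm (\<lambda>x. u m x - u n x) < e" if "m \<ge> N" "n \<ge> N" for m n
    proof -
      have "nrm (\<lambda>x. u m x - u n x) = nrm (\<lambda>x. (u m x - u N x) - (u n x - u N x))" by simp
      also have "\<dots> \<le> nrm (\<lambda>x. u m x - u N x) + nrm (\<lambda>x. u n x - u N x)"
        by (intro nrm_diff diff_mem u_mem)
      also have "\<dots> \<le> q ^ N * B + q ^ N * B"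
        using cauchy[of N "m - N"] cauchy[of N "n - N"] that by (intro add_mono) auto
      finally show ?thesis using N by (simp add: mult_ac)
    qed
    then show ?thesis by blast
  qed
  obtain g where g: "g \<in> F" and lim: "(\<lambda>n. nrm (\<lambda>x. u n x - g x)) \<longlonglongrightarrow> 0"
    using cauchy_limit[of u, OF u_mem small] by metis
  define w where "w = (\<lambda>x. \<Phi> g x - g x)"
  have w: "w \<in> F" unfolding w_def by (intro diff_mem \<Phi>_mem g)
  have "nrm w \<le> q * nrm (\<lambda>x. u n x - g x) + nrm (\<lambda>x. u (Suc n) x - g x)" for n
  proof -
    have "nrm w = nrm (\<lambda>x. (u (Suc n) x - g x) - (u (Suc n) x - \<Phi> g x))" by (simp add: w_def)
    also have "\<dots> \<le> nrm (\<lambda>x. u (Suc n) x - g x) + nrm (\<lambda>x. u (Suc n) x - \<Phi> g x)"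
      by (intro nrm_diff diff_mem u_mem g \<Phi>_mem)
    finally show ?thesis using \<Phi>_contr[OF u_mem[of n] g] by (simp add: uSuc)
  qed
  moreover have "(\<lambda>n. q * nrm (\<lambda>x. u n x - g x) + nrm (\<lambda>x. u (Suc n) x - g x)) \<longlonglongrightarrow> q * 0 + 0"
    by (intro tendsto_intros lim LIMSEQ_Suc[OF lim])
  ultimately have "nrm w \<le> 0" by (intro LIMSEQ_le_const[of _ "0::real"]) auto
  then have "AE x in M. w x = 0" using nrm_eq_0[OF w] nrm_nonneg[OF w] by simp
  then have "AE x in M. z * g x - U g x = f x"
    by eventually_elim (use z0 in \<open>auto simp: w_def \<Phi>_def field_simps\<close>)
  then show ?thesis using g by blast
qed

text \<open>The a priori bound \<open>(\<bar>z\<bar> - K) * nrm g \<le> nrm (z g - U g)\<close> makes the solution of the previous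
  lemma unique, linear in the right hand side and bounded.\<close>

lemma spectrum_bounded:
  assumes U: "bounded_linear_op M F nrm U" and K: "\<And>f. f \<in> F \<Longrightarrow> nrm (U f) \<le> K * nrm f"
    and "K \<ge> 0" "z \<in> op_spectrum M F nrm U"
  shows "cmod z \<le> K"
proof (rule ccontr)
  assume "\<not> cmod z \<le> K"
  then have zK: "cmod z > K" by simp
  define D where "D g = (\<lambda>x. z * g x - U g x)" for g
  have D_mem: "D g \<in> F" if "g \<in> F" for g
    unfolding D_def by (intro diff_mem scale_mem op_mem[OF U] that)
  have apriori: "(cmod z - K) * nrm g \<le> nrm (D g)" if g: "g \<in> F" for g
  proof -
    have "cmod z * nrm g = nrm (\<lambda>x. D g x + U g x)" by (simp add: D_def nrm_scale g)
    also have "\<dots> \<le> nrm (D g) + nrm (U g)" by (intro nrm_add D_mem op_mem[OF U] g)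
    finally show ?thesis using K[OF g] by (simp add: algebra_simps)
  qed
  have D_diff: "AE x in M. D (\<lambda>y. g y - h y) x = D g x - D h x" if "g \<in> F" "h \<in> F" for g h
    using op_diff[OF U that] by eventually_elim (auto simp: D_def algebra_simps)
  have inj: "AE x in M. g x = h x" if g: "g \<in> F" and h: "h \<in> F" and eq: "AE x in M. D g x = D h x" for g h
  proof -
    have "AE x in M. D (\<lambda>y. g y - h y) x = 0" using D_diff[OF g h] eq by eventually_elim simp
    then have "(cmod z - K) * nrm (\<lambda>y. g y - h y) \<le> 0"
      using apriori[OF diff_mem[OF g h]] nrm_eq_0[OF D_mem[OF diff_mem[OF g h]]] by simp
    then have "nrm (\<lambda>y. g y - h y) = 0"
      using zK nrm_nonneg[OF diff_mem[OF g h]] by (simp add: mult_le_0_iff)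
    then show ?thesis using nrm_eq_0[OF diff_mem[OF g h]] by simp
  qed
  define R where "R f = (SOME g. g \<in> F \<and> (AE x in M. D g x = f x))" for f
  have R: "R f \<in> F" "AE x in M. D (R f) x = f x" if "f \<in> F" for f
    using someI_ex[of "\<lambda>g. g \<in> F \<and> (AE x in M. D g x = f x)"]
      neumann_solution[OF U K \<open>K \<ge> 0\<close> zK that] unfolding R_def D_def by blast+
  have "bounded_linear_op M F nrm R"
    unfolding bounded_linear_op_def
  proof (intro conjI ballI allI exI)
    show "R f \<in> F" if "f \<in> F" for f using R that by blast
    show "AE x in M. R (\<lambda>y. f y + g y) x = R f x + R g x" if f: "f \<in> F" and g: "g \<in> F" for f g
    proof (rule inj)
      show "AE x in M. D (R (\<lambda>y. f y + g y)) x = D (\<lambda>x. R f x + R g x) x"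
        using R(2)[OF add_mem[OF f g]] R(2)[OF f] R(2)[OF g] op_add[OF U R(1)[OF f] R(1)[OF g]]
        by eventually_elim (auto simp: D_def algebra_simps)
    qed (intro add_mem R f g)+
    show "AE x in M. R (\<lambda>y. c * f y) x = c * R f x" if f: "f \<in> F" for f c
    proof (rule inj)
      show "AE x in M. D (R (\<lambda>y. c * f y)) x = D (\<lambda>x. c * R f x) x"
        using R(2)[OF scale_mem[OF f, of c]] R(2)[OF f] op_scale[OF U R(1)[OF f], of c]
        unfolding D_def by eventually_elim (metis mult.left_commute right_diff_distrib)
    qed (intro scale_mem R f)+
    show "nrm (R f) \<le> 1 / (cmod z - K) * nrm f" if f: "f \<in> F" for f
    proof -
      have "nrm (D (R f)) = nrm f"
        using AE_closed(2)[OF D_mem[OF R(1)[OF f]] meas[OF f] R(2)[OF f]] by simp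
      then show ?thesis using apriori[OF R(1)[OF f]] zK by (simp add: field_simps)
    qed
  qed
  moreover have "AE x in M. R (\<lambda>y. z * f y - U f y) x = f x" if f: "f \<in> F" for f
    using inj[OF R(1)[OF D_mem[OF f]] f] R(2)[OF D_mem[OF f]] by (simp add: D_def)
  moreover have "AE x in M. z * R f x - U (R f) x = f x" if f: "f \<in> F" for f
    using R(2)[OF f] by (simp add: D_def)
  ultimately show False using assms(4) unfolding op_spectrum_def by blast
qed

text \<open>The spectral radius is defined as a real supremum, which is meaningful because the spectrum is
  bounded.\<close>

lemma cmod_le_spectral_radius:
  assumes U: "bounded_linear_op M F nrm U" and "z \<in> op_spectrum M F nrm U"
  shows "cmod z \<le> op_spectral_radius M F nrm U"
proof -
  obtain K where "K \<ge> 0" "\<And>f. f \<in> F \<Longrightarrow> nrm (U f) \<le> K * nrm f" using op_bound[OF U] by metis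
  then have "bdd_above (cmod ` op_spectrum M F nrm U)"
    using spectrum_bounded[OF U] by (intro bdd_aboveI[of _ K]) auto
  then show ?thesis unfolding op_spectral_radius_def using assms(2) by (intro cSup_upper) auto
qed

end

section \<open>The transfer operator of a measure preserving map\<close>

lemma mult_cnj_sgn: "z * cnj (sgn z) = complex_of_real (cmod z)"
proof (cases "z = 0")
  case False
  have "z * cnj (sgn z) = z * cnj z / complex_of_real (cmod z)" by (simp add: sgn_eq)
  also have "\<dots> = complex_of_real (cmod z)"
    using False by (simp add: complex_norm_square[symmetric] power2_eq_square)
  finally show ?thesis .
qed simp

lemma measurable_cnj_sgn [measurable]:
  assumes [measurable]: "f \<in> borel_measurable M"
  shows "(\<lambda>x. cnj (sgn (f x :: complex))) \<in> borel_measurable M"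
proof -
  have [measurable]: "cnj \<in> borel_measurable borel"
    by (intro borel_measurable_continuous_onI continuous_intros)
  show ?thesis unfolding sgn_div_norm by measurable
qed

locale measure_preserving = prob_space M for M :: "'a measure" +
  fixes T :: "'a \<Rightarrow> 'a"
  assumes T_meas [measurable]: "T \<in> measurable M M" and invariant: "distr M M T = M"
begin

lemma funpow_measurable [measurable]: "T ^^ k \<in> measurable M M"
  by (induction k) (auto intro: measurable_comp)

lemma distr_funpow: "distr M M (T ^^ k) = M"
proof (induction k)
  case 0
  then show ?case by (simp add: distr_id2)
next
  case (Suc k)
  have "distr M M (T ^^ Suc k) = distr (distr M M (T ^^ k)) M T"
    by (simp add: distr_distr comp_def)
  then show ?case unfolding Suc invariant .
qed

lemma integrable_mult_bounded:
  fixes f h :: "'a \<Rightarrow> complex"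
  assumes "integrable M f" "h \<in> borel_measurable M" "AE x in M. cmod (h x) \<le> C"
  shows "integrable M (\<lambda>x. f x * h x)"
proof (rule Bochner_Integration.integrable_bound[of M "\<lambda>x. C * cmod (f x)"])
  show "AE x in M. norm (f x * h x) \<le> norm (C * cmod (f x))"
    using assms(3)
  proof eventually_elim
    case (elim x)
    have "cmod (h x) * cmod (f x) \<le> C * cmod (f x)" by (intro mult_right_mono elim) simp
    then show ?case by (simp add: norm_mult mult.commute abs_of_nonneg order_trans[OF norm_ge_zero elim])
  qed
qed (use assms in auto)

lemma AE_funpow:
  assumes "AE x in M. P x"
  shows "AE x in M. P ((T ^^ k) x)"
  using assms by (subst (asm) distr_funpow[of k, symmetric]) (rule AE_distrD[OF funpow_measurable])

lemma integral_funpow: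
  fixes f :: "'a \<Rightarrow> 'b :: {banach, second_countable_topology}"
  assumes "f \<in> borel_measurable M"
  shows "(\<integral>x. f ((T ^^ k) x) \<partial>M) = (\<integral>x. f x \<partial>M)"
  using integral_distr[OF funpow_measurable assms, of k] by (simp add: distr_funpow)

text \<open>\<open>g\<close> is the Radon-Nikodym density of the image under \<open>T\<close> of the measure with density \<open>f\<close>; the
  image has a density because the preimages of null sets are null sets.\<close>

lemma transfer_density_nonneg:
  fixes f :: "'a \<Rightarrow> real"
  assumes f: "integrable M f" and nonneg: "\<And>x. 0 \<le> f x"
  shows "\<exists>g::'a \<Rightarrow> real. integrable M g \<and> (\<forall>h\<in>borel_measurable M.
           (\<integral>x. complex_of_real (g x) * h x \<partial>M) = (\<integral>x. complex_of_real (f x) * h (T x) \<partial>M))"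
proof -
  have [measurable]: "f \<in> borel_measurable M" using f by simp
  define \<nu> where "\<nu> = distr (density M (\<lambda>x. ennreal (f x))) M T"
  have sets: "sets \<nu> = sets M" by (simp add: \<nu>_def)
  have emb: "emeasure \<nu> A = (\<integral>\<^sup>+x. ennreal (f x) * indicator (T -` A \<inter> space M) x \<partial>M)" if "A \<in> sets M" for A
    using that by (simp add: \<nu>_def emeasure_distr emeasure_density)
  have "emeasure \<nu> (space \<nu>) < \<infinity>"
  proof -
    have "emeasure \<nu> (space \<nu>) \<le> (\<integral>\<^sup>+x. ennreal (f x) \<partial>M)"
      using emb[of "space M"] by (auto simp: \<nu>_def intro!: nn_integral_mono split: split_indicator)
    also have "\<dots> < \<infinity>" using f nonneg by (simp add: nn_integral_eq_integral)
    finally show ?thesis .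
  qed
  then interpret \<nu>: finite_measure \<nu> by (intro finite_measureI) auto
  have "absolutely_continuous M \<nu>"
    unfolding absolutely_continuous_def
  proof
    fix A assume A: "A \<in> null_sets M"
    then have "A \<in> sets M" by auto
    have "emeasure M (T -` A \<inter> space M) = emeasure (distr M M T) A"
      using \<open>A \<in> sets M\<close> by (simp add: emeasure_distr)
    then have "T -` A \<inter> space M \<in> null_sets M"
      using A \<open>A \<in> sets M\<close> invariant by (auto intro!: null_setsI)
    then have "emeasure \<nu> A = 0"
      using emb[OF \<open>A \<in> sets M\<close>] by (simp add: nn_integral_null_set)
    then show "A \<in> null_sets \<nu>" using sets \<open>A \<in> sets M\<close> by (auto intro!: null_setsI)
  qed
  then obtain D where D [measurable]: "D \<in> borel_measurable M"
    and D_eq: "AE x in M. RN_deriv M \<nu> x = ennreal (D x)" and D0: "\<And>x. 0 \<le> D x"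
    using real_RN_deriv[OF \<nu>.finite_measure_axioms _ sets] by metis
  have dens: "density M (\<lambda>x. ennreal (D x)) = \<nu>"
  proof -
    have "density M (\<lambda>x. ennreal (D x)) = density M (RN_deriv M \<nu>)"
      using D_eq by (intro density_cong) auto
    then show ?thesis using density_RN_deriv[OF \<open>absolutely_continuous M \<nu>\<close> sets] by simp
  qed
  have "(\<integral>\<^sup>+x. ennreal (D x) \<partial>M) = emeasure \<nu> (space M)"
    unfolding dens[symmetric] by (subst emeasure_density) (auto intro!: nn_integral_cong)
  then have "integrable M D"
    using \<open>emeasure \<nu> (space \<nu>) < \<infinity>\<close> D0 by (intro integrableI_nonneg) (auto simp: \<nu>_def)
  moreover have "(\<integral>x. complex_of_real (D x) * h x \<partial>M) = (\<integral>x. complex_of_real (f x) * h (T x) \<partial>M)"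
    if [measurable]: "h \<in> borel_measurable M" for h :: "'a \<Rightarrow> complex"
  proof -
    have "(\<integral>x. complex_of_real (D x) * h x \<partial>M) = (\<integral>x. h x \<partial>\<nu>)"
      unfolding dens[symmetric] by (subst integral_density) (auto simp: D0 scaleR_conv_of_real)
    also have "\<dots> = (\<integral>x. h (T x) \<partial>density M (\<lambda>x. ennreal (f x)))"
      unfolding \<nu>_def by (subst integral_distr) auto
    also have "\<dots> = (\<integral>x. complex_of_real (f x) * h (T x) \<partial>M)"
      by (subst integral_density) (auto simp: nonneg scaleR_conv_of_real)
    finally show ?thesis .
  qed
  ultimately show ?thesis by blast
qed

text \<open>Existence for the positive and negative parts of the real and imaginary parts extends to complex
  \<open>f\<close> by linearity. It gives meaning to the choice in the definition of the transfer operator.\<close>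

lemma transfer_density_exists:
  fixes f :: "'a \<Rightarrow> complex"
  assumes f: "integrable M f"
  shows "\<exists>g::'a \<Rightarrow> complex. integrable M g \<and> (\<forall>h\<in>borel_measurable M. (\<exists>C. AE x in M. cmod (h x) \<le> C) \<longrightarrow>
           (\<integral>x. g x * h x \<partial>M) = (\<integral>x. f x * h (T x) \<partial>M))"
proof -
  have [measurable]: "f \<in> borel_measurable M" using f by simp
  have Re: "integrable M (\<lambda>x. Re (f x))" and Im: "integrable M (\<lambda>x. Im (f x))" using f by auto
  define f1 f2 f3 f4 where "f1 x = max 0 (Re (f x))" and "f2 x = max 0 (- Re (f x))"
    and "f3 x = max 0 (Im (f x))" and "f4 x = max 0 (- Im (f x))" for x
  note f_defs = f1_def f2_def f3_def f4_def
  have int: "integrable M f1" "integrable M f2" "integrable M f3" "integrable M f4"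
    unfolding f_defs using Re Im by auto
  have f_split: "f x = of_real (f1 x) - of_real (f2 x) + \<i> * (of_real (f3 x) - of_real (f4 x))" for x
    by (auto simp: f_defs complex_eq_iff)
  have ex: "\<exists>g::'a \<Rightarrow> real. integrable M g \<and> (\<forall>h\<in>borel_measurable M.
     (\<integral>x. complex_of_real (g x) * h x \<partial>M) = (\<integral>x. complex_of_real (f' x) * h (T x) \<partial>M))"
    if "f' \<in> {f1, f2, f3, f4}" for f'
    using that int by (intro transfer_density_nonneg) (auto simp: f_defs)
  obtain g1 g2 g3 g4 :: "'a \<Rightarrow> real" where g: "integrable M g1" "integrable M g2" "integrable M g3" "integrable M g4"
    and eq: "\<forall>h\<in>borel_measurable M. (\<integral>x. complex_of_real (g1 x) * h x \<partial>M) = (\<integral>x. complex_of_real (f1 x) * h (T x) \<partial>M)"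
     "\<forall>h\<in>borel_measurable M. (\<integral>x. complex_of_real (g2 x) * h x \<partial>M) = (\<integral>x. complex_of_real (f2 x) * h (T x) \<partial>M)"
     "\<forall>h\<in>borel_measurable M. (\<integral>x. complex_of_real (g3 x) * h x \<partial>M) = (\<integral>x. complex_of_real (f3 x) * h (T x) \<partial>M)"
     "\<forall>h\<in>borel_measurable M. (\<integral>x. complex_of_real (g4 x) * h x \<partial>M) = (\<integral>x. complex_of_real (f4 x) * h (T x) \<partial>M)"
    using ex[of f1] ex[of f2] ex[of f3] ex[of f4] by auto
  define g where "g x = complex_of_real (g1 x) - complex_of_real (g2 x)
      + \<i> * (complex_of_real (g3 x) - complex_of_real (g4 x))" for x
  have "integrable M g" unfolding g_def using g by auto
  moreover have "(\<integral>x. g x * h x \<partial>M) = (\<integral>x. f x * h (T x) \<partial>M)"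
    if h: "h \<in> borel_measurable M" and C: "AE x in M. cmod (h x) \<le> C" for h C
  proof -
    have C': "AE x in M. cmod (h (T x)) \<le> C" using AE_funpow[OF C, of 1] by simp
    have hT: "(\<lambda>x. h (T x)) \<in> borel_measurable M" using h by measurable
    have 1: "integrable M (\<lambda>x. complex_of_real (k x) * h x)" if "integrable M k" for k
      using that by (intro integrable_mult_bounded[OF _ h C]) auto
    have 2: "integrable M (\<lambda>x. complex_of_real (k x) * h (T x))" if "integrable M k" for k
      using that by (intro integrable_mult_bounded[OF _ hT C']) auto
    have "(\<integral>x. g x * h x \<partial>M) = (\<integral>x. (of_real (g1 x) * h x - of_real (g2 x) * h x)
       + \<i> * (of_real (g3 x) * h x - of_real (g4 x) * h x) \<partial>M)"
      by (intro Bochner_Integration.integral_cong) (auto simp: g_def algebra_simps)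
    also have "\<dots> = ((\<integral>x. of_real (g1 x) * h x \<partial>M) - (\<integral>x. of_real (g2 x) * h x \<partial>M))
       + \<i> * ((\<integral>x. of_real (g3 x) * h x \<partial>M) - (\<integral>x. of_real (g4 x) * h x \<partial>M))"
      using g by (simp add: 1)
    also have "\<dots> = ((\<integral>x. of_real (f1 x) * h (T x) \<partial>M) - (\<integral>x. of_real (f2 x) * h (T x) \<partial>M))
       + \<i> * ((\<integral>x. of_real (f3 x) * h (T x) \<partial>M) - (\<integral>x. of_real (f4 x) * h (T x) \<partial>M))"
      using eq h by simp
    also have "\<dots> = (\<integral>x. (of_real (f1 x) * h (T x) - of_real (f2 x) * h (T x))
       + \<i> * (of_real (f3 x) * h (T x) - of_real (f4 x) * h (T x)) \<partial>M)"
      using int by (simp add: 2)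
    also have "\<dots> = (\<integral>x. f x * h (T x) \<partial>M)"
      by (intro Bochner_Integration.integral_cong refl) (subst f_split, simp add: algebra_simps)
    finally show ?thesis .
  qed
  ultimately show ?thesis by blast
qed

lemma
  fixes f :: "'a \<Rightarrow> complex"
  assumes "integrable M f"
  shows transfer_integrable: "integrable M (transfer_operator M T f)"
    and transfer_dual: "h \<in> borel_measurable M \<Longrightarrow> AE x in M. cmod (h x) \<le> C \<Longrightarrow>
      (\<integral>x. transfer_operator M T f x * h x \<partial>M) = (\<integral>x. f x * h (T x) \<partial>M)"
  using someI_ex[OF transfer_density_exists[OF assms]]
  unfolding transfer_operator_def[symmetric] by blast+

text \<open>The test function is the conjugate of the phase of \<open>f - g\<close>, which turns the integral into the
  \<open>L\<^sup>1\<close> distance.\<close>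

lemma AE_eq_if_tested:
  fixes f g :: "'a \<Rightarrow> complex"
  assumes f: "integrable M f" and g: "integrable M g"
    and eq: "\<And>h. h \<in> borel_measurable M \<Longrightarrow> (\<And>x. cmod (h x) \<le> 1) \<Longrightarrow>
        (\<integral>x. f x * h x \<partial>M) = (\<integral>x. g x * h x \<partial>M)"
  shows "AE x in M. f x = g x"
proof -
  have [measurable]: "f \<in> borel_measurable M" "g \<in> borel_measurable M" using f g by auto
  define h where "h x = cnj (sgn (f x - g x))" for x
  have h [measurable]: "h \<in> borel_measurable M" unfolding h_def by measurable
  have h1: "cmod (h x) \<le> 1" for x by (simp add: h_def norm_sgn)
  have fg: "(f x - g x) * h x = complex_of_real (cmod (f x - g x))" for x
    unfolding h_def by (rule mult_cnj_sgn)
  have "complex_of_real (\<integral>x. cmod (f x - g x) \<partial>M) = (\<integral>x. f x * h x - g x * h x \<partial>M)"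
    by (simp add: fg[symmetric] left_diff_distrib[symmetric] flip: integral_complex_of_real)
  also have "\<dots> = 0"
    using eq[OF h h1] h1
    by (subst Bochner_Integration.integral_diff) (auto intro!: integrable_mult_bounded f g)
  finally have "(\<integral>x. cmod (f x - g x) \<partial>M) = 0" by simp
  then have "AE x in M. f x - g x = 0"
    using f g integral_nonneg_eq_0_iff_AE[of M "\<lambda>x. cmod (f x - g x)"] by simp
  then show ?thesis by simp
qed

lemma transfer_one: "AE x in M. transfer_operator M T (\<lambda>x. 1) x = 1"
proof (rule AE_eq_if_tested)
  fix h :: "'a \<Rightarrow> complex" assume h: "h \<in> borel_measurable M" "\<And>x. cmod (h x) \<le> 1"
  then show "(\<integral>x. transfer_operator M T (\<lambda>x. 1) x * h x \<partial>M) = (\<integral>x. 1 * h x \<partial>M)"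
    using transfer_dual[of "\<lambda>x. 1" h 1] integral_funpow[of h 1] by simp
qed (auto intro: transfer_integrable)

text \<open>The transfer operator contracts the \<open>L\<^sup>1\<close> norm, as is seen by pairing \<open>T_hat e\<close> with its conjugate phase.\<close>

lemma transfer_eigenvalue_le_1:
  fixes e :: "'a \<Rightarrow> complex"
  assumes e: "integrable M e" and nz: "\<not> (AE x in M. e x = 0)"
    and eig: "AE x in M. transfer_operator M T e x = l * e x"
  shows "cmod l \<le> 1"
proof -
  have [measurable]: "e \<in> borel_measurable M" using e by auto
  define h where "h x = cnj (sgn (l * e x))" for x
  have h [measurable]: "h \<in> borel_measurable M" unfolding h_def by measurable
  have h1: "cmod (h x) \<le> 1" for x by (simp add: h_def norm_sgn)
  have le: "l * e x * h x = complex_of_real (cmod (l * e x))" for x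
    unfolding h_def by (rule mult_cnj_sgn)
  have "complex_of_real (\<integral>x. cmod (l * e x) \<partial>M) = (\<integral>x. l * e x * h x \<partial>M)"
    by (simp add: le flip: integral_complex_of_real)
  also have "\<dots> = (\<integral>x. transfer_operator M T e x * h x \<partial>M)"
    using eig e by (intro integral_cong_AE) (auto dest: transfer_integrable)
  also have "\<dots> = (\<integral>x. e x * h (T x) \<partial>M)" using transfer_dual[OF e h, of 1] h1 by simp
  finally have "cmod (complex_of_real (\<integral>x. cmod (l * e x) \<partial>M)) = cmod (\<integral>x. e x * h (T x) \<partial>M)"
    by (rule arg_cong)
  then have "cmod l * (\<integral>x. cmod (e x) \<partial>M) = cmod (\<integral>x. e x * h (T x) \<partial>M)"
    by (simp add: norm_mult abs_mult)
  also have "\<dots> \<le> (\<integral>x. cmod (e x * h (T x)) \<partial>M)" by simp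
  also have "\<dots> \<le> (\<integral>x. cmod (e x) \<partial>M)"
    using h1 e by (intro integral_mono integrable_norm integrable_mult_bounded[where C = 1])
      (auto simp: norm_mult mult_left_le)
  finally have "cmod l * (\<integral>x. cmod (e x) \<partial>M) \<le> 1 * (\<integral>x. cmod (e x) \<partial>M)" by simp
  moreover have "(\<integral>x. cmod (e x) \<partial>M) > 0"
    using nz e integral_nonneg_eq_0_iff_AE[of M "\<lambda>x. cmod (e x)"]
    by (simp add: less_le Bochner_Integration.integral_nonneg)
  ultimately show ?thesis by (rule mult_right_le_imp_le)
qed

end

section \<open>Poisson's equation and summed correlations\<close>

locale spectral_gap_system =
  fixes M :: "'a measure" and T :: "'a \<Rightarrow> 'a"
    and F :: "('a \<Rightarrow> complex) set" and nrm :: "('a \<Rightarrow> complex) \<Rightarrow> real"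
  assumes property_C: "property_C M T F nrm"

sublocale spectral_gap_system \<subseteq> function_algebra M F nrm
  using property_C by unfold_locales (simp add: property_C_def)

sublocale spectral_gap_system \<subseteq> measure_preserving M T
proof -
  have "nonsingular_map M T" "prob_space M" "distr M M T = M"
    using property_C unfolding property_C_def by auto
  then show "measure_preserving M T"
    by (simp add: measure_preserving_def measure_preserving_axioms_def nonsingular_map_def)
qed

context spectral_gap_system
begin

abbreviation "T_hat \<equiv> transfer_operator M T"

lemma const_mem: "(\<lambda>x. c) \<in> F"
  using property_C unfolding property_C_def by auto

lemma AE_le_nrm:
  assumes "f \<in> F"
  shows "AE x in M. cmod (f x) \<le> nrm f"
proof -
  have "esssup M (\<lambda>x. ereal (cmod (f x))) \<le> ereal (nrm f)"
    using property_C assms unfolding property_C_def by blast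
  then show ?thesis
    using esssup_AE[where M = M and f = "\<lambda>x. ereal (cmod (f x))"] by (auto elim!: eventually_mono dest: order_trans)
qed

lemma F_integrable: "f \<in> F \<Longrightarrow> integrable M f"
  using integrable_const_bound[OF AE_le_nrm meas] by blast

lemma T_hat_op: "bounded_linear_op M F nrm T_hat"
  and spectral_gap: "has_spectral_gap M F nrm T_hat"
  using property_C unfolding property_C_def has_spectral_gap_def by blast+

lemma integral_T_hat:
  assumes "f \<in> F"
  shows "(\<integral>x. T_hat f x \<partial>M) = (\<integral>x. f x \<partial>M)"
  using transfer_dual[OF F_integrable[OF assms], of "\<lambda>x. 1" 1] by simp

lemma AE_const_eq: "(AE x in M. c = d) \<Longrightarrow> c = d"
  using AE_const[of "c = d"] by simp

text \<open>Since \<open>T_hat\<close> fixes the constants and contracts \<open>L\<^sup>1\<close>, the leading eigenvalue can only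
  be \<open>1\<close>: otherwise \<open>P 1 = 0\<close>, so that \<open>N\<close> would have the eigenvalue \<open>1\<close>, in spite of
  \<open>\<rho>(N) < \<bar>l\<bar> \<le> 1\<close>.\<close>

lemma spectral_decomposition:
  obtains P N where "bounded_linear_op M F nrm P" "bounded_linear_op M F nrm N"
    "\<forall>f\<in>F. AE x in M. T_hat f x = P f x + N f x"
    "\<forall>f\<in>F. AE x in M. P (N f) x = 0"
    "\<forall>f\<in>F. \<exists>c. AE x in M. P f x = c"
    "AE x in M. P (\<lambda>x. 1) x = 1"
    "1 \<notin> op_spectrum M F nrm N"
proof -
  obtain l P N e where P: "bounded_linear_op M F nrm P" and N: "bounded_linear_op M F nrm N"
    and dec: "\<forall>f\<in>F. AE x in M. T_hat f x = l * P f x + N f x"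
    and PP: "\<forall>f\<in>F. AE x in M. P (P f) x = P f x"
    and e: "e \<in> F" "\<not> (AE x in M. e x = 0)" "\<exists>f\<in>F. AE x in M. P f x = e x"
    and Pe: "\<forall>f\<in>F. \<exists>c. AE x in M. P f x = c * e x"
    and rad: "op_spectral_radius M F nrm N < cmod l"
    and PN: "\<forall>f\<in>F. AE x in M. P (N f) x = 0"
    and NP: "\<forall>f\<in>F. AE x in M. N (P f) x = 0"
    using spectral_gap unfolding has_spectral_gap_def by (elim conjE exE bexE) (rule that, (assumption | rule bexI)+)
  let ?one = "\<lambda>x::'a. 1::complex"
  note one = const_mem[of 1]
  note P_mem = op_mem[OF P] and N_mem = op_mem[OF N]
  have "cmod l \<le> 1"
  proof (rule transfer_eigenvalue_le_1[OF F_integrable[OF e(1)] e(2)])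
    obtain f where f: "f \<in> F" "AE x in M. P f x = e x" using e(3) by blast
    have "AE x in M. T_hat e x = T_hat (P f) x"
      using op_cong[OF T_hat_op P_mem[OF f(1)] e(1) f(2)] by eventually_elim simp
    moreover note dec[rule_format, OF P_mem[OF f(1)]] PP[rule_format, OF f(1)] NP[rule_format, OF f(1)] f(2)
    ultimately show "AE x in M. T_hat e x = l * e x" by eventually_elim simp
  qed
  have 1: "AE x in M. l * P ?one x + N ?one x = 1"
    using transfer_one dec[rule_format, OF one] by eventually_elim simp
  have "AE x in M. P ?one x = l * P ?one x"
  proof -
    have "AE x in M. P ?one x = P (\<lambda>x. l * P ?one x + N ?one x) x"
      using 1 by (intro op_cong[OF P one add_mem[OF scale_mem[OF P_mem[OF one]] N_mem[OF one]]]) (auto elim: eventually_mono)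
    moreover note op_add[OF P scale_mem[OF P_mem[OF one], of l] N_mem[OF one]] op_scale[OF P P_mem[OF one], of l]
      PN[rule_format, OF one] PP[rule_format, OF one]
    ultimately show ?thesis by eventually_elim simp
  qed
  have l1: "l = 1"
  proof (rule ccontr)
    assume "l \<noteq> 1"
    with \<open>AE x in M. P ?one x = l * P ?one x\<close> have "AE x in M. P ?one x = 0"
      by (auto elim!: eventually_mono)
    with 1 have N1: "AE x in M. 1 * ?one x - N ?one x = 0" by eventually_elim simp
    have "1 \<in> op_spectrum M F nrm N"
      unfolding op_spectrum_def
    proof (rule CollectI, rule notI, elim exE conjE)
      fix R assume R: "bounded_linear_op M F nrm R"
        and inv: "\<forall>f\<in>F. (AE x in M. R (\<lambda>y. 1 * f y - N f y) x = f x) \<and> (AE x in M. 1 * R f x - N (R f) x = f x)"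
      have "AE x in M. R (\<lambda>y. 1 * ?one y - N ?one y) x = 0"
        using op_zero[OF R _ N1] diff_mem[OF one N_mem[OF one]] by simp
      moreover have "AE x in M. R (\<lambda>y. 1 * ?one y - N ?one y) x = ?one x"
        using inv[rule_format, OF one] by (rule conjunct1)
      ultimately have "AE x in M. (0::complex) = 1" by eventually_elim simp
      then show False using AE_const_eq by force
    qed
    from cmod_le_spectral_radius[OF N this] rad \<open>cmod l \<le> 1\<close> show False by simp
  qed
  have spec: "1 \<notin> op_spectrum M F nrm N"
    using cmod_le_spectral_radius[OF N, of 1] rad l1 by auto
  have P1: "AE x in M. P ?one x = 1"
  proof -
    obtain R where R: "bounded_linear_op M F nrm R"
      and inv: "\<forall>f\<in>F. AE x in M. R (\<lambda>y. 1 * f y - N f y) x = f x"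
      using spec unfolding op_spectrum_def by blast
    have "AE x in M. N ?one x = N (\<lambda>x. P ?one x + N ?one x) x"
      using 1 l1 by (intro op_cong[OF N one add_mem[OF P_mem[OF one] N_mem[OF one]]]) (auto elim: eventually_mono)
    moreover note op_add[OF N P_mem[OF one] N_mem[OF one]] NP[rule_format, OF one]
    ultimately have "AE x in M. 1 * N ?one x - N (N ?one) x = 0" by eventually_elim simp
    then have "AE x in M. R (\<lambda>x. 1 * N ?one x - N (N ?one) x) x = 0"
      using op_zero[OF R] diff_mem[OF N_mem[OF one] N_mem[OF N_mem[OF one]]] by simp
    with inv[rule_format, OF N_mem[OF one]] 1 show ?thesis by eventually_elim (simp add: l1)
  qed
  obtain c where c: "AE x in M. P ?one x = c * e x" using Pe one by blast
  with P1 have c': "AE x in M. c * e x = 1" by eventually_elim simp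
  have "c \<noteq> 0"
  proof
    assume "c = 0"
    then have "AE x in M. (0::complex) = 1" using c' by simp
    then show False using AE_const_eq by force
  qed
  have Pconst: "\<exists>d. AE x in M. P f x = d" if f: "f \<in> F" for f
  proof -
    obtain d where "AE x in M. P f x = d * e x" using bspec[OF Pe f] by (elim exE)
    with c' have "AE x in M. P f x = d / c"
    proof eventually_elim
      case (elim x)
      have "d * e x = d * (c * e x) / c" using \<open>c \<noteq> 0\<close> by simp
      then show ?case using elim by simp
    qed
    then show ?thesis by (rule exI)
  qed
  show thesis
    using that[OF P N _ PN _ P1 spec] dec l1 Pconst by simp
qed

text \<open>The solution is \<open>h = (1 - N)\<^sup>-\<^sup>1 (f - P f)\<close>. It lies in the kernel of \<open>P\<close>, on which
  the transfer operator is \<open>N\<close>; integrating the equation identifies \<open>P f\<close> as the mean of \<open>f\<close>.\<close>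

lemma poisson_equation:
  obtains C where "C \<ge> 0"
    "\<forall>f\<in>F. \<exists>h\<in>F. nrm h \<le> C * nrm f \<and>
       (AE x in M. f x - (\<integral>y. f y \<partial>M) = h x - T_hat h x)"
proof -
  obtain P N where P: "bounded_linear_op M F nrm P" and N: "bounded_linear_op M F nrm N"
    and dec': "\<forall>f\<in>F. AE x in M. T_hat f x = P f x + N f x"
    and PN': "\<forall>f\<in>F. AE x in M. P (N f) x = 0"
    and Pconst': "\<forall>f\<in>F. \<exists>c. AE x in M. P f x = c"
    and P1: "AE x in M. P (\<lambda>x. 1) x = 1"
    and spec: "1 \<notin> op_spectrum M F nrm N"
    by (rule spectral_decomposition)
  note dec = dec'[rule_format] and PN = PN'[rule_format] and Pconst = Pconst'[rule_format]
  obtain R where R: "bounded_linear_op M F nrm R"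
    and inv: "\<forall>f\<in>F. AE x in M. 1 * R f x - N (R f) x = f x"
    using spec unfolding op_spectrum_def by blast
  obtain K where K: "K \<ge> 0" "\<And>f. f \<in> F \<Longrightarrow> nrm (R f) \<le> K * nrm f" using op_bound[OF R] by blast
  let ?one = "\<lambda>x::'a. 1::complex"
  note one = const_mem[of 1]
  show thesis
  proof (rule that[of "K * (1 + nrm ?one)"])
    show "0 \<le> K * (1 + nrm ?one)" using K(1) nrm_nonneg[OF one] by simp
    show "\<forall>f\<in>F. \<exists>h\<in>F. nrm h \<le> K * (1 + nrm ?one) * nrm f \<and>
       (AE x in M. f x - (\<integral>y. f y \<partial>M) = h x - T_hat h x)"
    proof
      fix f assume f: "f \<in> F"
      obtain c where c: "AE x in M. P f x = c" using Pconst[OF f] by blast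
      define f0 where "f0 = (\<lambda>x. f x - c * ?one x)"
      have f0: "f0 \<in> F" unfolding f0_def by (intro diff_mem scale_mem one f)
      have Pf0: "AE x in M. P f0 x = 0"
        using op_diff[OF P f scale_mem[OF one, of c]] op_scale[OF P one, of c] P1 c
        unfolding f0_def by eventually_elim simp
      define h where "h = R f0"
      have h: "h \<in> F" unfolding h_def by (rule op_mem[OF R f0])
      have hN: "AE x in M. h x - N h x = f0 x" using inv f0 by (simp add: h_def)
      \<comment> \<open>\<open>P h = P (h - N h) = P f0 = 0\<close>, hence \<open>T_hat h = N h\<close>.\<close>
      have "AE x in M. P h x = 0"
      proof -
        have "AE x in M. P (\<lambda>x. h x - N h x) x = P f0 x"
          using hN by (intro op_cong[OF P diff_mem[OF h op_mem[OF N h]] f0])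
        moreover note op_diff[OF P h op_mem[OF N h]] PN[OF h] Pf0
        ultimately show ?thesis by eventually_elim simp
      qed
      with dec[OF h] hN have eq: "AE x in M. f x - c = h x - T_hat h x"
        by eventually_elim (simp add: f0_def)
      have "(\<integral>x. f x - c \<partial>M) = (\<integral>x. h x - T_hat h x \<partial>M)"
        using eq meas[OF f] meas[OF h] meas[OF op_mem[OF T_hat_op h]] by (intro integral_cong_AE) auto
      then have "(\<integral>x. f x \<partial>M) - c = 0"
        using F_integrable[OF f] F_integrable[OF h] F_integrable[OF op_mem[OF T_hat_op h]] integral_T_hat[OF h]
        by (simp add: prob_space)
      then have c_eq: "c = (\<integral>x. f x \<partial>M)" by simp
      have "cmod c \<le> nrm f"
      proof -
        have "cmod c \<le> (\<integral>x. cmod (f x) \<partial>M)" unfolding c_eq by simp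
        also have "\<dots> \<le> (\<integral>x. nrm f \<partial>M)"
          using F_integrable[OF f] AE_le_nrm[OF f] by (intro integral_mono_AE) auto
        finally show ?thesis by (simp add: prob_space)
      qed
      have "nrm h \<le> K * nrm f0" unfolding h_def by (rule K(2)[OF f0])
      also have "\<dots> \<le> K * (nrm f + nrm f * nrm ?one)"
      proof (intro mult_left_mono K(1))
        have "nrm f0 \<le> nrm f + cmod c * nrm ?one"
          using nrm_diff[OF f scale_mem[OF one, of c]] nrm_scale[OF one, of c] by (simp add: f0_def)
        then show "nrm f0 \<le> nrm f + nrm f * nrm ?one"
          using mult_right_mono[OF \<open>cmod c \<le> nrm f\<close> nrm_nonneg[OF one]] by simp
      qed
      finally have "nrm h \<le> K * (1 + nrm ?one) * nrm f" by (simp add: algebra_simps)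
      with h eq show "\<exists>h\<in>F. nrm h \<le> K * (1 + nrm ?one) * nrm f \<and>
         (AE x in M. f x - (\<integral>y. f y \<partial>M) = h x - T_hat h x)" unfolding c_eq by blast
    qed
  qed
qed

text \<open>With \<open>f - \<integral>f = h - T_hat h\<close>, duality moves \<open>T_hat\<close> onto the other factor: the \<open>k\<close>-th correlation is
  \<open>a k - a (Suc k)\<close> with \<open>a k = \<integral>h \<cdot> g \<circ> T\<^sup>k\<close>, and the sum telescopes.\<close>

lemma summed_correlations:
  "\<exists>C\<ge>0. \<forall>f\<in>F. \<forall>g\<in>borel_measurable M. \<forall>B m. (AE x in M. cmod (g x) \<le> B) \<longrightarrow>
       cmod (\<Sum>k=1..m. (\<integral>x. f x * g ((T ^^ k) x) \<partial>M) - (\<integral>x. f x \<partial>M) * (\<integral>x. g x \<partial>M))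
         \<le> C * nrm f * (\<integral>x. cmod (g x) \<partial>M)"
proof -
  obtain C where C: "C \<ge> 0" "\<forall>f\<in>F. \<exists>h\<in>F. nrm h \<le> C * nrm f \<and>
       (AE x in M. f x - (\<integral>y. f y \<partial>M) = h x - T_hat h x)"
    by (rule poisson_equation)
  show ?thesis
  proof (intro exI[of _ "2 * C"] conjI ballI allI impI)
    fix f g B and m :: nat
    assume f: "f \<in> F" and g [measurable]: "g \<in> borel_measurable M" and B: "AE x in M. cmod (g x) \<le> B"
    let ?c = "\<integral>x. f x \<partial>M"
    obtain h where h: "h \<in> F" and h_le: "nrm h \<le> C * nrm f"
      and eq: "AE x in M. f x - ?c = h x - T_hat h x" using C(2) f by blast
    have [measurable]: "f \<in> borel_measurable M" "h \<in> borel_measurable M" "T_hat h \<in> borel_measurable M"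
      using f h op_mem[OF T_hat_op h] meas by auto
    have gk [measurable]: "(\<lambda>x. g ((T ^^ k) x)) \<in> borel_measurable M" for k
      by (rule measurable_compose[OF funpow_measurable g])
    have Bk: "AE x in M. cmod (g ((T ^^ k) x)) \<le> B" for k using AE_funpow[OF B] .
    have int: "integrable M (\<lambda>x. u x * g ((T ^^ k) x))" if "u \<in> F" for u k
      by (rule integrable_mult_bounded[OF F_integrable[OF that] gk Bk])
    have gint: "integrable M g" using integrable_const_bound[OF B g] .
    define a where "a k = (\<integral>x. h x * g ((T ^^ k) x) \<partial>M)" for k
    have step: "(\<integral>x. f x * g ((T ^^ k) x) \<partial>M) - ?c * (\<integral>x. g x \<partial>M) = a k - a (Suc k)" for k
    proof -
      have "(\<integral>x. f x * g ((T ^^ k) x) \<partial>M) - ?c * (\<integral>x. g x \<partial>M)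
          = (\<integral>x. f x * g ((T ^^ k) x) \<partial>M) - (\<integral>x. ?c * g ((T ^^ k) x) \<partial>M)"
        using integral_funpow[OF g, of k] by simp
      also have "\<dots> = (\<integral>x. f x * g ((T ^^ k) x) - ?c * g ((T ^^ k) x) \<partial>M)"
        using int[OF f] int[OF const_mem] by simp
      also have "\<dots> = (\<integral>x. h x * g ((T ^^ k) x) - T_hat h x * g ((T ^^ k) x) \<partial>M)"
      proof (rule integral_cong_AE)
        show "AE x in M. f x * g ((T ^^ k) x) - ?c * g ((T ^^ k) x)
            = h x * g ((T ^^ k) x) - T_hat h x * g ((T ^^ k) x)"
          using eq by eventually_elim (metis left_diff_distrib)
      qed measurable
      also have "\<dots> = a k - (\<integral>x. T_hat h x * g ((T ^^ k) x) \<partial>M)"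
        using int[OF h] int[OF op_mem[OF T_hat_op h]] by (simp add: a_def)
      also have "(\<integral>x. T_hat h x * g ((T ^^ k) x) \<partial>M) = a (Suc k)"
        using transfer_dual[OF F_integrable[OF h] gk Bk] by (simp add: a_def funpow_swap1)
      finally show ?thesis .
    qed
    have a_le: "cmod (a k) \<le> C * nrm f * (\<integral>x. cmod (g x) \<partial>M)" for k
    proof -
      have "cmod (a k) \<le> (\<integral>x. cmod (h x * g ((T ^^ k) x)) \<partial>M)" unfolding a_def by simp
      also have "\<dots> \<le> (\<integral>x. nrm h * cmod (g ((T ^^ k) x)) \<partial>M)"
      proof (rule integral_mono_AE)
        show "AE x in M. cmod (h x * g ((T ^^ k) x)) \<le> nrm h * cmod (g ((T ^^ k) x))"
          using AE_le_nrm[OF h] by eventually_elim (auto simp: norm_mult intro: mult_right_mono)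
        show "integrable M (\<lambda>x. nrm h * cmod (g ((T ^^ k) x)))"
          using int[OF const_mem[of 1], of k] by simp
      qed (use int[OF h, of k] in auto)
      also have "\<dots> = nrm h * (\<integral>x. cmod (g x) \<partial>M)"
        using integral_funpow[of "\<lambda>x. cmod (g x)" k] by simp
      also have "\<dots> \<le> C * nrm f * (\<integral>x. cmod (g x) \<partial>M)"
        by (intro mult_right_mono h_le) simp
      finally show ?thesis .
    qed
    have "(\<Sum>k=1..m. (\<integral>x. f x * g ((T ^^ k) x) \<partial>M) - ?c * (\<integral>x. g x \<partial>M)) = a 1 - a (Suc m)"
      unfolding step by (induction m) auto
    also have "cmod \<dots> \<le> cmod (a 1) + cmod (a (Suc m))" by (rule norm_triangle_ineq4)
    also have "\<dots> \<le> 2 * C * nrm f * (\<integral>x. cmod (g x) \<partial>M)" using a_le[of 1] a_le[of "Suc m"] by simp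
    finally show "cmod (\<Sum>k=1..m. (\<integral>x. f x * g ((T ^^ k) x) \<partial>M) - ?c * (\<integral>x. g x \<partial>M)) \<le> \<dots>" .
  qed (use C in simp)
qed

end

section \<open>Counting exceedances\<close>

locale observable = measure_preserving M T for M :: "'a measure" and T +
  fixes chi :: "'a \<Rightarrow> real"
  assumes chi_meas [measurable]: "chi \<in> borel_measurable M"
begin

definition exceeds :: "real \<Rightarrow> nat \<Rightarrow> 'a set" where
  "exceeds u k = {x \<in> space M. u < chi ((T ^^ k) x)}"

definition Gbar :: "real \<Rightarrow> real" where
  "Gbar u = prob {x \<in> space M. u < chi x}"

definition exceed_count :: "nat set \<Rightarrow> real \<Rightarrow> 'a \<Rightarrow> nat" where
  "exceed_count J u x = card {k \<in> J. u < chi ((T ^^ k) x)}"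

lemma orbit_measurable [measurable]: "(\<lambda>x. chi ((T ^^ k) x)) \<in> borel_measurable M"
  by (rule measurable_compose[OF funpow_measurable chi_meas])

lemma exceeds_sets [measurable]: "exceeds u k \<in> sets M"
  unfolding exceeds_def by measurable

lemma Gbar_nonneg: "0 \<le> Gbar u" and Gbar_le_1: "Gbar u \<le> 1"
  by (auto simp: Gbar_def)

lemma Gbar_antimono: "u \<le> v \<Longrightarrow> Gbar v \<le> Gbar u"
  unfolding Gbar_def by (intro finite_measure_mono) auto

lemma prob_vimage_funpow:
  assumes "A \<in> sets M"
  shows "prob ((T ^^ k) -` A \<inter> space M) = prob A"
  using measure_distr[OF funpow_measurable assms, of k] by (simp add: distr_funpow)

lemma prob_exceeds: "prob (exceeds u k) = Gbar u"
proof -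
  have "exceeds u k = (T ^^ k) -` {x \<in> space M. u < chi x} \<inter> space M"
    using measurable_space[OF funpow_measurable] by (auto simp: exceeds_def)
  then show ?thesis unfolding Gbar_def by (simp add: prob_vimage_funpow del: vimage_Collect_eq)
qed

lemma prob_exceeds_Int:
  assumes "i \<le> j"
  shows "prob (exceeds u i \<inter> exceeds u j) = prob (exceeds u 0 \<inter> exceeds u (j - i))"
proof -
  have "(T ^^ j) x = (T ^^ (j - i)) ((T ^^ i) x)" for x
    using assms by (simp flip: funpow_add[THEN fun_cong, unfolded comp_apply])
  then have "exceeds u i \<inter> exceeds u j = (T ^^ i) -` (exceeds u 0 \<inter> exceeds u (j - i)) \<inter> space M"
    using measurable_space[OF funpow_measurable] by (auto simp: exceeds_def)
  then show ?thesis by (simp add: prob_vimage_funpow del: vimage_Int)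
qed

lemma count_eq_sum:
  assumes "finite J" "x \<in> space M"
  shows "real (exceed_count J u x) = (\<Sum>k\<in>J. indicator (exceeds u k) x)"
proof -
  have "(\<Sum>k\<in>J. indicator (exceeds u k) x :: real) = (\<Sum>k\<in>J. if u < chi ((T ^^ k) x) then 1 else 0)"
    using assms(2) by (intro sum.cong) (auto simp: exceeds_def indicator_def)
  also have "\<dots> = real (exceed_count J u x)"
    using assms(1) by (simp add: exceed_count_def sum.If_cases Int_def)
  finally show ?thesis by simp
qed

lemma count_measurable [measurable]:
  assumes "finite J"
  shows "(\<lambda>x. real (exceed_count J u x)) \<in> borel_measurable M"
  by (subst measurable_cong[OF count_eq_sum[OF assms]]) measurable

lemma count_le: "finite J \<Longrightarrow> exceed_count J u x \<le> card J"
  unfolding exceed_count_def by (intro card_mono) auto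

lemma count_integrable:
  assumes "finite J"
  shows "integrable M (\<lambda>x. real (exceed_count J u x))"
  using assms by (intro integrable_const_bound[of _ "real (card J)"]) (auto simp: count_le)

lemma expectation_count:
  assumes "finite J"
  shows "(\<integral>x. real (exceed_count J u x) \<partial>M) = real (card J) * Gbar u"
proof -
  have "(\<integral>x. real (exceed_count J u x) \<partial>M) = (\<integral>x. (\<Sum>k\<in>J. indicator (exceeds u k) x) \<partial>M)"
    using assms by (intro Bochner_Integration.integral_cong refl) (rule count_eq_sum)
  also have "\<dots> = (\<Sum>k\<in>J. prob (exceeds u k))"
    by (subst Bochner_Integration.integral_sum) (auto simp: integrable_indicator_iff less_top[symmetric])
  finally show ?thesis by (simp add: prob_exceeds)
qed

lemma double_sum_abs_diff:
  fixes c :: "nat \<Rightarrow> real"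
  shows "(\<Sum>i<Suc n. \<Sum>j<Suc n. c (if i \<le> j then j - i else i - j))
       = (\<Sum>i<n. \<Sum>j<n. c (if i \<le> j then j - i else i - j)) + 2 * (\<Sum>k=1..n. c k) + c 0"
proof -
  have "(\<Sum>i<n. c (n - i)) = (\<Sum>k=1..n. c k)"
    by (rule sum.reindex_bij_witness[of _ "\<lambda>k. n - k" "\<lambda>i. n - i"]) auto
  then show ?thesis by (simp add: sum.distrib)
qed

text \<open>By stationarity the variance is a double sum of \<open>c \<bar>i - j\<bar>\<close> for the correlations \<open>c k\<close>,
  and it grows by \<open>2 * (\<Sum>k=1..n. c k) + c 0\<close> from \<open>n\<close> to \<open>n + 1\<close>.\<close>

lemma count_variance:
  assumes C: "\<And>m. \<bar>\<Sum>k=1..m. prob (exceeds u 0 \<inter> exceeds u k) - (Gbar u)\<^sup>2\<bar> \<le> C * Gbar u"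
  shows "(\<integral>x. (real (exceed_count {..<n} u x) - real n * Gbar u)\<^sup>2 \<partial>M) \<le> (1 + 2 * C) * (real n * Gbar u)"
proof -
  define G where "G = Gbar u"
  define c where "c k = prob (exceeds u 0 \<inter> exceeds u k) - G\<^sup>2" for k
  define Y where "Y k x = indicator (exceeds u k) x - G" for k x
  have int_ind: "integrable M (indicator A :: 'a \<Rightarrow> real)" if "A \<in> sets M" for A
    using that by (simp add: integrable_indicator_iff less_top[symmetric])
  have YY_eq: "Y i x * Y j x = indicator (exceeds u i \<inter> exceeds u j) x
      - G * indicator (exceeds u i) x - G * indicator (exceeds u j) x + G\<^sup>2" for i j x
    by (auto simp: Y_def algebra_simps power2_eq_square split: split_indicator)
  have YY_int: "integrable M (\<lambda>x. Y i x * Y j x)" for i j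
    unfolding YY_eq using int_ind by simp
  have YY: "(\<integral>x. Y i x * Y j x \<partial>M) = c (if i \<le> j then j - i else i - j)" for i j
  proof -
    have "(\<integral>x. Y i x * Y j x \<partial>M) = prob (exceeds u i \<inter> exceeds u j) - G * G - G * G + G\<^sup>2"
      unfolding YY_eq using int_ind by (simp add: prob_exceeds prob_space G_def)
    also have "prob (exceeds u i \<inter> exceeds u j) = prob (exceeds u 0 \<inter> exceeds u (if i \<le> j then j - i else i - j))"
      using prob_exceeds_Int[of i j u] prob_exceeds_Int[of j i u] by (simp add: Int_commute)
    finally show ?thesis by (simp add: c_def power2_eq_square)
  qed
  have "(\<integral>x. (real (exceed_count {..<n} u x) - real n * G)\<^sup>2 \<partial>M) = (\<integral>x. (\<Sum>i<n. \<Sum>j<n. Y i x * Y j x) \<partial>M)"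
  proof (intro Bochner_Integration.integral_cong refl)
    fix x assume "x \<in> space M"
    then have "real (exceed_count {..<n} u x) - real n * G = (\<Sum>i<n. Y i x)"
      by (simp add: count_eq_sum Y_def sum_subtractf)
    then show "(real (exceed_count {..<n} u x) - real n * G)\<^sup>2 = (\<Sum>i<n. \<Sum>j<n. Y i x * Y j x)"
      by (simp add: power2_eq_square sum_product)
  qed
  also have "\<dots> = (\<Sum>i<n. \<Sum>j<n. c (if i \<le> j then j - i else i - j))"
    by (simp add: Bochner_Integration.integral_sum YY_int YY)
  also have "\<dots> \<le> (1 + 2 * C) * (real n * G)"
  proof (induction n)
    case (Suc n)
    have "c 0 \<le> G" by (simp add: c_def prob_exceeds G_def)
    moreover have "(\<Sum>k=1..n. c k) \<le> C * G" using C[of n] by (simp add: c_def G_def abs_le_iff)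
    ultimately show ?case unfolding double_sum_abs_diff using Suc by (simp add: algebra_simps)
  qed simp
  finally show ?thesis by (simp add: G_def)
qed

text \<open>\<open>2 \<bar>z\<bar> \<le> t + z\<^sup>2 / t\<close> trades the square for the absolute value. The parameter \<open>t\<close> is chosen later as
  the square root of the number of trimmed values.\<close>

lemma count_mean_deviation:
  assumes C: "\<And>m. \<bar>\<Sum>k=1..m. prob (exceeds u 0 \<inter> exceeds u k) - (Gbar u)\<^sup>2\<bar> \<le> C * Gbar u"
    and "t > 0"
  shows "(\<integral>x. \<bar>real (exceed_count {..<n} u x) - real n * Gbar u\<bar> \<partial>M) \<le> (t + (1 + 2 * C) * (real n * Gbar u) / t) / 2"
proof -
  define Z where "Z x = real (exceed_count {..<n} u x) - real n * Gbar u" for x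
  have [measurable]: "Z \<in> borel_measurable M" unfolding Z_def by measurable
  have bound: "\<bar>Z x\<bar> \<le> real n + real n * Gbar u" for x
    using count_le[of "{..<n}" u x] Gbar_nonneg[of u] unfolding Z_def
    by (intro abs_leI) (auto intro: order_trans[of _ "real n"] simp: add_increasing2 add_increasing)
  have int: "integrable M Z" using bound by (intro integrable_const_bound) auto
  have int2: "integrable M (\<lambda>x. (Z x)\<^sup>2)"
    using power_mono[OF bound abs_ge_zero, where n = 2] by (intro integrable_const_bound) auto
  have "\<bar>Z x\<bar> \<le> (t + (Z x)\<^sup>2 / t) / 2" for x
  proof -
    have "0 \<le> (\<bar>Z x\<bar> - t)\<^sup>2" by simp
    then have "2 * t * \<bar>Z x\<bar> \<le> t\<^sup>2 + (Z x)\<^sup>2" by (simp add: power2_diff mult_ac)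
    then show ?thesis using \<open>t > 0\<close> by (simp add: field_simps power2_eq_square)
  qed
  then have "(\<integral>x. \<bar>Z x\<bar> \<partial>M) \<le> (\<integral>x. (t + (Z x)\<^sup>2 / t) / 2 \<partial>M)"
    using int int2 by (intro integral_mono) auto
  also have "\<dots> = (t + (\<integral>x. (Z x)\<^sup>2 \<partial>M) / t) / 2" using int2 by (simp add: prob_space)
  also have "\<dots> \<le> (t + (1 + 2 * C) * (real n * Gbar u) / t) / 2"
    using count_variance[OF C, of n] \<open>t > 0\<close> unfolding Z_def by (intro divide_right_mono add_left_mono) auto
  finally show ?thesis by (simp add: Z_def)
qed

end

section \<open>Moments of the count under mixing\<close>

context observable begin

text \<open>The coefficient is a supremum of distances of \<open>P(A \<inter> B) / (P(A) P(B))\<close> from \<open>1\<close>, so this quotient is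
  less than \<open>2\<close>; for null events the bound follows from monotonicity of the measure.\<close>

lemma psi_mixing_Int_le:
  assumes psi: "psi_mixing_coeff M X r < 1" and X: "\<And>j. X j \<in> borel_measurable M"
    and k: "k \<ge> 1" and A: "A \<in> generated_sigma_field M X {1..k}" and B: "B \<in> generated_sigma_field M X {k + r..}"
  shows "prob (A \<inter> B) \<le> 2 * prob A * prob B"
proof -
  have sub: "generated_sigma_field M X J \<subseteq> sets M" for J
    unfolding generated_sigma_field_def using X
    by (intro sets.sigma_sets_subset) (auto intro: measurable_sets)
  then have AM: "A \<in> sets M" and BM: "B \<in> sets M" using A B by blast+
  show ?thesis
  proof (cases "prob A > 0 \<and> prob B > 0")
    case False
    then have "prob A = 0 \<or> prob B = 0" by (simp add: less_le)
    moreover have "prob (A \<inter> B) \<le> prob A" "prob (A \<inter> B) \<le> prob B"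
      using AM BM by (auto intro: finite_measure_mono)
    ultimately show ?thesis by (auto simp: le_less)
  next
    case True
    let ?q = "prob (A \<inter> B) / (prob A * prob B)"
    have "ereal \<bar>?q - 1\<bar> \<le> psi_dependence M (generated_sigma_field M X {1..k}) (generated_sigma_field M X {k + r..})"
      unfolding psi_dependence_def using A B True by (intro SUP_upper2[of "(A, B)"]) auto
    also have "\<dots> \<le> psi_mixing_coeff M X r"
      unfolding psi_mixing_coeff_def using k by (intro SUP_upper) auto
    finally have "ereal \<bar>?q - 1\<bar> < 1" using psi by (rule le_less_trans)
    then have "?q \<le> 2" by simp
    then show ?thesis using True by (simp add: field_simps)
  qed
qed

text \<open>The last index is split off, one factor \<open>2 * Gbar u\<close> at a time. The exceedance at time \<open>k\<close> belongs to
  the variable with index \<open>k + 1\<close> of the mixing sequence.\<close>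

lemma prob_exceeds_separated:
  assumes psi: "psi_mixing_coeff M (\<lambda>n x. chi ((T ^^ (n - 1)) x)) r < 1"
    and "finite I" and sep: "\<And>i j. i \<in> I \<Longrightarrow> j \<in> I \<Longrightarrow> i < j \<Longrightarrow> i + r \<le> j"
  shows "prob {x \<in> space M. \<forall>k\<in>I. u < chi ((T ^^ k) x)} \<le> (2 * Gbar u) ^ card I"
  using assms(2) sep
proof (induction I rule: finite_linorder_max_induct)
  case empty
  then show ?case by simp
next
  case (insert m I)
  let ?X = "\<lambda>n x. chi ((T ^^ (n - 1)) x)"
  let ?A = "{x \<in> space M. \<forall>k\<in>I. u < chi ((T ^^ k) x)}"
  have IH: "prob ?A \<le> (2 * Gbar u) ^ card I" using insert by auto
  have eq: "{x \<in> space M. \<forall>k\<in>insert m I. u < chi ((T ^^ k) x)} = ?A \<inter> exceeds u m"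
    by (auto simp: exceeds_def)
  have "prob (?A \<inter> exceeds u m) \<le> 2 * prob ?A * prob (exceeds u m)"
  proof (cases "I = {}")
    case True
    then show ?thesis using measure_nonneg[of M "exceeds u m"]
      by (simp add: prob_space exceeds_def Int_absorb1 del: measure_nonneg)
  next
    case False
    define K where "K = Suc (Max I)"
    have gen: "exceeds u k \<in> generated_sigma_field M ?X J" if "Suc k \<in> J" for k J
      unfolding generated_sigma_field_def
    proof (rule sigma_sets.Basic, rule UN_I[OF that], rule CollectI, intro exI conjI)
      show "exceeds u k = (\<lambda>x. chi ((T ^^ (Suc k - 1)) x)) -` {u<..} \<inter> space M"
        by (auto simp: exceeds_def)
    qed simp
    interpret \<Sigma>: sigma_algebra "space M" "generated_sigma_field M ?X {1..K}"
      unfolding generated_sigma_field_def by (intro sigma_algebra_sigma_sets) auto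
    have "Max I \<in> I" using insert.hyps(1) False by (rule Max_in)
    have "?A = (\<Inter>k\<in>I. exceeds u k)" using False by (auto simp: exceeds_def)
    moreover have "(\<Inter>k\<in>I. exceeds u k) \<in> generated_sigma_field M ?X {1..K}"
      using insert.hyps(1) False gen by (intro \<Sigma>.finite_INT) (auto simp: K_def)
    moreover have "exceeds u m \<in> generated_sigma_field M ?X {K + r..}"
      using insert.prems[of "Max I" m] insert.hyps(2) \<open>Max I \<in> I\<close> by (intro gen) (auto simp: K_def)
    ultimately show ?thesis
      by (intro psi_mixing_Int_le[OF psi, of K]) (auto simp: K_def)
  qed
  also have "\<dots> \<le> 2 * (2 * Gbar u) ^ card I * Gbar u"
    using IH Gbar_nonneg[of u] by (simp add: prob_exceeds mult_right_mono)
  also have "\<dots> = (2 * Gbar u) ^ card (insert m I)" using insert.hyps by (subst card_insert_disjoint) auto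
  finally show ?case unfolding eq .
qed

text \<open>The binomial coefficient counts the subsets of size \<open>p\<close> all of whose members are exceedances.\<close>

lemma expectation_count_choose:
  assumes psi: "psi_mixing_coeff M (\<lambda>n x. chi ((T ^^ (n - 1)) x)) r < 1"
    and J: "finite J" and sep: "\<And>i j. i \<in> J \<Longrightarrow> j \<in> J \<Longrightarrow> i < j \<Longrightarrow> i + r \<le> j"
  shows "integrable M (\<lambda>x. real (exceed_count J u x choose p))"
    and "(\<integral>x. real (exceed_count J u x choose p) \<partial>M) \<le> (2 * (real (card J) * Gbar u)) ^ p"
proof -
  let ?S = "{I. I \<subseteq> J \<and> card I = p}"
  let ?E = "\<lambda>I. {x \<in> space M. \<forall>k\<in>I. u < chi ((T ^^ k) x)}"
  have fin: "finite ?S" using J by auto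
  have finI: "finite I" if "I \<in> ?S" for I using that J finite_subset by auto
  have E_sets: "?E I \<in> sets M" if "I \<in> ?S" for I
    using finI[OF that] by measurable
  have int_ind: "integrable M (indicator A :: 'a \<Rightarrow> real)" if "A \<in> sets M" for A
    using that by (simp add: integrable_indicator_iff less_top[symmetric])
  have eq: "real (exceed_count J u x choose p) = (\<Sum>I\<in>?S. indicator (?E I) x)" if x: "x \<in> space M" for x
  proof -
    have "exceed_count J u x choose p = card {I. I \<subseteq> {k \<in> J. u < chi ((T ^^ k) x)} \<and> card I = p}"
      unfolding exceed_count_def using J by (subst n_subsets) auto
    also have "{I. I \<subseteq> {k \<in> J. u < chi ((T ^^ k) x)} \<and> card I = p} = {I \<in> ?S. x \<in> ?E I}"
      using x by auto
    also have "real (card {I \<in> ?S. x \<in> ?E I}) = (\<Sum>I\<in>?S. indicator (?E I) x)"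
      using fin by (simp add: indicator_def of_bool_def sum.If_cases Int_def)
    finally show ?thesis .
  qed
  show "integrable M (\<lambda>x. real (exceed_count J u x choose p))"
    by (subst Bochner_Integration.integrable_cong[OF refl eq]) (auto intro!: Bochner_Integration.integrable_sum int_ind E_sets)
  have "(\<integral>x. real (exceed_count J u x choose p) \<partial>M) = (\<integral>x. (\<Sum>I\<in>?S. indicator (?E I) x) \<partial>M)"
    using eq by (intro Bochner_Integration.integral_cong refl)
  also have "\<dots> = (\<Sum>I\<in>?S. prob (?E I))"
    using E_sets int_ind by (subst Bochner_Integration.integral_sum) (auto intro!: sum.cong simp: Int_absorb2)
  also have "\<dots> \<le> (\<Sum>I\<in>?S. (2 * Gbar u) ^ p)"
  proof (rule sum_mono)
    fix I assume I: "I \<in> ?S"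
    then show "prob (?E I) \<le> (2 * Gbar u) ^ p"
      using prob_exceeds_separated[OF psi finI[OF I], of u] sep by auto
  qed
  also have "\<dots> = real (card J choose p) * (2 * Gbar u) ^ p" using J by (simp add: n_subsets)
  also have "\<dots> \<le> real (card J) ^ p * (2 * Gbar u) ^ p"
  proof (intro mult_right_mono)
    show "real (card J choose p) \<le> real (card J) ^ p"
    proof (cases "p \<le> card J")
      case True
      then show ?thesis by (metis binomial_le_pow of_nat_le_iff of_nat_power)
    qed (simp add: binomial_eq_0)
  qed (simp add: Gbar_nonneg)
  finally show "(\<integral>x. real (exceed_count J u x choose p) \<partial>M) \<le> (2 * (real (card J) * Gbar u)) ^ p"
    by (simp add: power_mult_distrib mult_ac)
qed

text \<open>From \<open>(m / p)\<^sup>p \<le> m choose p\<close>, trading \<open>p - 1\<close> of the factors \<open>m\<close> for the threshold \<open>s\<close>.\<close>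

lemma le_choose_if_large:
  assumes "p \<ge> 1" "real p \<le> s" "s \<le> real m"
  shows "real m * s ^ (p - 1) \<le> real p ^ p * real (m choose p)"
proof -
  have "p \<le> m" using assms by linarith
  have "real m * s ^ (p - 1) \<le> real m * real m ^ (p - 1)"
    using assms by (intro mult_left_mono power_mono) auto
  also have "\<dots> = real m ^ p" using \<open>p \<ge> 1\<close> by (cases p) auto
  also have "\<dots> = real p ^ p * (real m / real p) ^ p" using \<open>p \<ge> 1\<close> by (simp add: power_divide)
  also have "\<dots> \<le> real p ^ p * real (m choose p)"
    using binomial_ge_n_over_k_pow_k[OF \<open>p \<le> m\<close>, where ?'a = real] by (intro mult_left_mono) auto
  finally show ?thesis .
qed

text \<open>The indices are split into residue classes modulo \<open>r\<close>, within which they are separated. The excess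
  of the total count over \<open>b\<close> is the sum over the classes of the (signed) excesses over \<open>b / r\<close>, and in a
  class with \<open>m \<ge> b / r\<close> exceedances \<open>m\<close> is dominated by \<open>m choose p\<close>.\<close>

lemma expectation_excess_le:
  assumes psi: "psi_mixing_coeff M (\<lambda>n x. chi ((T ^^ (n - 1)) x)) r < 1"
    and r: "r \<ge> 1" and p: "p \<ge> 1" and b: "real b \<ge> real r * real p"
  shows "(\<integral>x. max 0 (real (exceed_count {..<n} u x) / real b - 1) \<partial>M) \<le> (2 * real p * real r * (real n * Gbar u / real b)) ^ p"
proof -
  define J where "J j = {k. k < n \<and> k mod r = j}" for j
  define s where "s = real b / real r"
  have b0: "real b > 0" using b r p by (smt (verit) mult_pos_pos of_nat_0_less_iff less_le_trans zero_less_one)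
  have s: "real p \<le> s" "s > 0" using b b0 r by (auto simp: s_def field_simps)
  have J: "finite (J j)" "card (J j) \<le> n" for j
    using card_mono[of "{..<n}" "J j"] by (auto simp: J_def)
  have sep: "i + r \<le> k" if "i \<in> J j" "k \<in> J j" "i < k" for i j k
  proof -
    have "r dvd k - i" using that by (auto simp: J_def intro: mod_eq_dvd_iff_nat[THEN iffD1])
    then have "r \<le> k - i" using that(3) by (intro dvd_imp_le) auto
    then show ?thesis using that(3) by simp
  qed
  have count_split: "exceed_count {..<n} u x = (\<Sum>j<r. exceed_count (J j) u x)" for x
  proof -
    have "{k \<in> {..<n}. u < chi ((T ^^ k) x)} = (\<Union>j<r. {k \<in> J j. u < chi ((T ^^ k) x)})"
      using r by (auto simp: J_def)
    also have "card \<dots> = (\<Sum>j<r. card {k \<in> J j. u < chi ((T ^^ k) x)})"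
      by (intro card_UN_disjoint) (auto simp: J_def)
    finally show ?thesis by (simp add: exceed_count_def)
  qed
  define K where "K = real p ^ p / (s ^ (p - 1) * real b)"
  have K0: "K \<ge> 0" using s b0 by (simp add: K_def)
  have pointwise: "max 0 (real (exceed_count {..<n} u x) / real b - 1) \<le> (\<Sum>j<r. K * real (exceed_count (J j) u x choose p))" for x
  proof -
    have "real (exceed_count (J j) u x) / real b - 1 / real r \<le> K * real (exceed_count (J j) u x choose p)" for j
    proof (cases "s \<le> real (exceed_count (J j) u x)")
      case True
      have "real (exceed_count (J j) u x) / real b = real (exceed_count (J j) u x) * s ^ (p - 1) / (s ^ (p - 1) * real b)"
        using s by simp
      also have "\<dots> \<le> real p ^ p * real (exceed_count (J j) u x choose p) / (s ^ (p - 1) * real b)"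
        using le_choose_if_large[OF p s(1) True] s b0 by (intro divide_right_mono) auto
      finally show ?thesis using r by (simp add: K_def) (smt (verit) divide_nonneg_nonneg of_nat_0_le_iff)
    next
      case False
      then have "real (exceed_count (J j) u x) / real b - 1 / real r \<le> 0" using b0 r by (simp add: s_def field_simps)
      then show ?thesis using K0 by (smt (verit) mult_nonneg_nonneg of_nat_0_le_iff)
    qed
    then have "(\<Sum>j<r. real (exceed_count (J j) u x) / real b - 1 / real r) \<le> (\<Sum>j<r. K * real (exceed_count (J j) u x choose p))"
      by (intro sum_mono)
    moreover have "(\<Sum>j<r. real (exceed_count (J j) u x) / real b - 1 / real r) = real (exceed_count {..<n} u x) / real b - 1"
      using r by (simp add: count_split sum_subtractf sum_divide_distrib)
    moreover have "0 \<le> (\<Sum>j<r. K * real (exceed_count (J j) u x choose p))" using K0 by (intro sum_nonneg) auto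
    ultimately show ?thesis by simp
  qed
  have moment: "integrable M (\<lambda>x. real (exceed_count (J j) u x choose p))"
      "(\<integral>x. real (exceed_count (J j) u x choose p) \<partial>M) \<le> (2 * (real (card (J j)) * Gbar u)) ^ p" for j
    by (rule expectation_count_choose[OF psi J(1)], rule sep, assumption+)+
  have "(\<integral>x. max 0 (real (exceed_count {..<n} u x) / real b - 1) \<partial>M) \<le> (\<integral>x. (\<Sum>j<r. K * real (exceed_count (J j) u x choose p)) \<partial>M)"
    using moment(1) pointwise count_integrable[of "{..<n}" u]
    by (intro integral_mono integrable_max Bochner_Integration.integrable_sum integrable_mult_right) auto
  also have "\<dots> = (\<Sum>j<r. K * (\<integral>x. real (exceed_count (J j) u x choose p) \<partial>M))"
    using moment(1) by (simp add: Bochner_Integration.integral_sum)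
  also have "\<dots> \<le> (\<Sum>j<r. K * (2 * (real n * Gbar u)) ^ p)"
  proof (intro sum_mono mult_left_mono K0)
    fix j
    have "(2 * (real (card (J j)) * Gbar u)) ^ p \<le> (2 * (real n * Gbar u)) ^ p"
      using J(2)[of j] Gbar_nonneg[of u] by (intro power_mono mult_left_mono mult_right_mono) auto
    then show "(\<integral>x. real (exceed_count (J j) u x choose p) \<partial>M) \<le> (2 * (real n * Gbar u)) ^ p"
      using moment(2)[of j] by linarith
  qed
  also have "\<dots> = (2 * real p * real r * (real n * Gbar u / real b)) ^ p"
  proof -
    have "real b = s * real r" using r by (simp add: s_def)
    then have "s ^ (p - 1) * real b = s ^ p * real r" using p by (cases p) auto
    then have "real r * (K * (2 * (real n * Gbar u)) ^ p) = (real p * (2 * (real n * Gbar u)) / s) ^ p"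
      using r by (simp add: K_def power_divide power_mult_distrib)
    also have "real p * (2 * (real n * Gbar u)) / s = 2 * real p * real r * (real n * Gbar u / real b)"
      by (simp add: s_def)
    finally show ?thesis by simp
  qed
  finally show ?thesis .
qed

end

section \<open>Trimmed sums as integrals of counts\<close>

lemma length_filter_drop_descending:
  fixes ys :: "real list"
  assumes "sorted_wrt (\<ge>) ys"
  shows "length (filter (\<lambda>y. u < y) (drop b ys)) = length (filter (\<lambda>y. u < y) ys) - b"
  using assms
proof (induction ys arbitrary: b)
  case (Cons y ys)
  show ?case
  proof (cases b)
    case (Suc b')
    show ?thesis
    proof (cases "u < y")
      case False
      then have "filter (\<lambda>y. u < y) ys = []" using Cons.prems by (fastforce simp: filter_empty_conv)
      then show ?thesis using Cons False Suc by simp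
    qed (use Cons Suc in simp)
  qed simp
qed simp

lemma sum_list_layer_cake:
  fixes xs :: "real list"
  assumes "\<forall>x\<in>set xs. 0 \<le> x" "s > 0"
  shows "has_bochner_integral lborel
    (\<lambda>v. indicator {0<..} v * real (length (filter (\<lambda>x. s * v < x) xs))) (sum_list xs / s)"
  using assms(1)
proof (induction xs)
  case (Cons x xs)
  have "has_bochner_integral lborel (indicator {0<..<x / s} :: real \<Rightarrow> real) (measure lborel {0<..<x / s})"
    using Cons.prems assms(2) by (intro has_bochner_integral_real_indicator) auto
  moreover have "measure lborel {0<..<x / s} = x / s" using Cons assms(2) by simp
  ultimately have "has_bochner_integral lborel (\<lambda>v. indicator {0<..<x / s} v
      + indicator {0<..} v * real (length (filter (\<lambda>x. s * v < x) xs))) (x / s + sum_list xs / s)"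
    using Cons by (intro has_bochner_integral_add) auto
  moreover have "(\<lambda>v. indicator {0<..<x / s} v + indicator {0<..} v * real (length (filter (\<lambda>x. s * v < x) xs)))
      = (\<lambda>v. indicator {0<..} v * real (length (filter (\<lambda>x. s * v < x) (x # xs))))"
    using assms(2) by (intro ext) (auto simp: field_simps split: split_indicator)
  ultimately show ?case by (simp add: add_divide_distrib)
qed (simp add: has_bochner_integral_zero)

context observable begin

text \<open>Trimming discards the \<open>b\<close> largest of the values above a level \<open>u\<close>, so that the number of remaining
  ones is the truncated difference \<open>exceed_count {..<n} u x - b\<close>.\<close>

lemma trimmed_sum_layer_cake:
  assumes nonneg: "\<And>k. 0 \<le> chi ((T ^^ k) x)" and l: "l > 0" and b: "b \<ge> 1"
  shows "has_bochner_integral lborel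
    (\<lambda>v. indicator {0<..} v * max 0 (real (exceed_count {..<n} (l * v) x) / real b - 1))
    (trimmed_sum T chi n b x / (real b * l))"
proof -
  let ?xs = "map (\<lambda>k. chi ((T ^^ k) x)) [0..<n]"
  let ?ys = "rev (sort ?xs)"
  have desc: "sorted_wrt (\<ge>) ?ys" by (simp add: sorted_wrt_rev)
  have "length (filter (\<lambda>y. u < y) ?ys) = exceed_count {..<n} u x" for u
  proof -
    have "length (filter (\<lambda>y. u < y) ?ys) = length (filter (\<lambda>y. u < y) ?xs)"
      by (metis mset_filter mset_rev mset_sort size_mset)
    also have "\<dots> = exceed_count {..<n} u x"
      by (simp add: exceed_count_def length_filter_conv_card cong: conj_cong)
    finally show ?thesis .
  qed
  then have len: "real (length (filter (\<lambda>y. u < y) (drop b ?ys))) / real b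
      = max 0 (real (exceed_count {..<n} u x) / real b - 1)" for u
    using b unfolding length_filter_drop_descending[OF desc]
    by (cases "b \<le> exceed_count {..<n} u x") (auto simp: of_nat_diff field_simps max_def)
  have "\<forall>y\<in>set (drop b ?ys). 0 \<le> y" using nonneg by (auto dest!: in_set_dropD)
  from has_bochner_integral_divide_zero[OF sum_list_layer_cake[OF this l], of "real b"]
  have "has_bochner_integral lborel (\<lambda>v. indicator {0<..} v * real (length (filter (\<lambda>x. l * v < x) (drop b ?ys))) / real b)
    (sum_list (drop b ?ys) / l / real b)" .
  then show ?thesis
    by (simp add: trimmed_sum_def mult.commute[of l] times_divide_eq_right[symmetric] len del: times_divide_eq_right)
qed

end

section \<open>Regularly varying tails\<close>

lemma ex_dyadic:
  fixes v :: real
  assumes "v \<ge> 1"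
  obtains k :: nat where "2 ^ k \<le> v" "v < 2 ^ Suc k"
proof -
  have ex: "\<exists>n. v < 2 ^ n" using real_arch_pow[of 2 v] by auto
  define m where "m = (LEAST n. v < 2 ^ n)"
  have m: "v < 2 ^ m" unfolding m_def by (rule LeastI_ex[OF ex])
  then obtain k where k: "m = Suc k" using assms by (cases m) auto
  then have "\<not> v < 2 ^ k" using not_less_Least[of k "\<lambda>n. v < 2 ^ n"] by (simp add: m_def)
  then show thesis using that[of k] m unfolding k by simp
qed

locale regularly_varying_tail =
  fixes G :: "real \<Rightarrow> real" and \<alpha> :: real
  assumes antimono: "u \<le> v \<Longrightarrow> G v \<le> G u" and pos: "x > 0 \<Longrightarrow> G x > 0" and le_1: "G x \<le> 1"
    and ratio: "c > 0 \<Longrightarrow> ((\<lambda>x. G (c * x) / G x) \<longlongrightarrow> c powr (- \<alpha>)) at_top"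
begin

text \<open>The two Potter bounds. Since \<open>G\<close> is monotone, it suffices to iterate the limit relation for
  \<open>c = 2\<close>.\<close>

lemma potter_above:
  assumes "\<gamma> < \<alpha>" "0 < \<gamma>"
  obtains C x0 where "C > 0" "x0 > 0" "\<And>x v. x \<ge> x0 \<Longrightarrow> v \<ge> 1 \<Longrightarrow> G (x * v) \<le> C * v powr (- \<gamma>) * G x"
proof -
  have "\<forall>\<^sub>F x in at_top. G (2 * x) / G x < 2 powr (- \<gamma>)"
    using ratio[of 2] assms by (intro order_tendstoD(2)[of _ "2 powr (- \<alpha>)"]) auto
  then obtain x1 where x1: "\<And>x. x \<ge> x1 \<Longrightarrow> G (2 * x) / G x < 2 powr (- \<gamma>)"
    unfolding eventually_at_top_linorder by blast
  define x0 where "x0 = max x1 1"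
  have step: "G (2 * x) \<le> 2 powr (- \<gamma>) * G x" if "x \<ge> x0" for x
    using x1[of x] pos[of x] that by (simp add: x0_def field_simps)
  have iter: "G (2 ^ k * x) \<le> (2 ^ k) powr (- \<gamma>) * G x" if x: "x \<ge> x0" for x k
  proof (induction k)
    case (Suc k)
    have "1 * x \<le> 2 ^ k * x" using x by (intro mult_right_mono) (auto simp: x0_def)
    then have "G (2 * (2 ^ k * x)) \<le> 2 powr (- \<gamma>) * G (2 ^ k * x)" using x by (intro step) simp
    also have "\<dots> \<le> 2 powr (- \<gamma>) * ((2 ^ k) powr (- \<gamma>) * G x)" using Suc by (intro mult_left_mono) auto
    finally show ?case by (simp add: powr_mult mult_ac)
  qed simp
  show thesis
  proof (rule that[of "2 powr \<gamma>" x0])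
    fix x v :: real assume x: "x \<ge> x0" and v: "v \<ge> 1"
    obtain k where k: "2 ^ k \<le> v" "v < 2 ^ Suc k" using ex_dyadic[OF v] .
    have x_pos: "x > 0" using x by (simp add: x0_def)
    have "G (x * v) \<le> G (2 ^ k * x)" using k x_pos by (intro antimono) (simp add: mult.commute)
    also have "\<dots> \<le> (2 ^ k) powr (- \<gamma>) * G x" by (rule iter[OF x])
    also have "\<dots> \<le> (v / 2) powr (- \<gamma>) * G x"
      using k v assms pos[OF x_pos] by (intro mult_right_mono powr_mono2') auto
    also have "(v / 2) powr (- \<gamma>) = 2 powr \<gamma> * v powr (- \<gamma>)"
      using v by (simp add: powr_divide powr_minus field_simps)
    finally show "G (x * v) \<le> 2 powr \<gamma> * v powr (- \<gamma>) * G x" .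
  qed (auto simp: x0_def)
qed

text \<open>Arguments \<open>x * v\<close> below the threshold of the limit relation are covered by \<open>G \<le> 1\<close>.\<close>

lemma potter_below:
  assumes "\<alpha> < \<beta>" "0 < \<beta>"
  obtains C x0 where "C > 0" "x0 > 0"
    "\<And>x v. x \<ge> x0 \<Longrightarrow> 0 < v \<Longrightarrow> v \<le> 1 \<Longrightarrow> G (x * v) \<le> C * v powr (- \<beta>) * G x"
proof -
  have "\<forall>\<^sub>F x in at_top. G (2 * x) / G x > 2 powr (- \<beta>)"
    using ratio[of 2] assms by (intro order_tendstoD(1)[of _ "2 powr (- \<alpha>)"]) auto
  then obtain x1 where x1: "\<And>x. x \<ge> x1 \<Longrightarrow> G (2 * x) / G x > 2 powr (- \<beta>)"
    unfolding eventually_at_top_linorder by blast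
  define x0 where "x0 = max x1 1"
  have x0: "x0 > 0" by (simp add: x0_def)
  have step: "G x \<le> 2 powr \<beta> * G (2 * x)" if "x \<ge> x0" for x
    using x1[of x] pos[of x] that by (simp add: x0_def field_simps powr_minus)
  have iter: "G x \<le> (2 ^ k) powr \<beta> * G (2 ^ k * x)" if x: "x \<ge> x0" for x k
  proof (induction k)
    case (Suc k)
    have "1 * x \<le> 2 ^ k * x" using x by (intro mult_right_mono) (auto simp: x0_def)
    then have "G (2 ^ k * x) \<le> 2 powr \<beta> * G (2 * (2 ^ k * x))" using x by (intro step) simp
    then have "(2 ^ k) powr \<beta> * G (2 ^ k * x) \<le> (2 ^ k) powr \<beta> * (2 powr \<beta> * G (2 * (2 ^ k * x)))"
      by (intro mult_left_mono) auto
    with Suc have "G x \<le> (2 ^ k) powr \<beta> * (2 powr \<beta> * G (2 * (2 ^ k * x)))" by (rule order_trans)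
    then show ?case by (simp add: powr_mult mult_ac)
  qed simp
  have above: "G y \<le> (2 * w) powr \<beta> * G (y * w)" if y: "y \<ge> x0" and w: "w \<ge> 1" for y w
  proof -
    obtain k where k: "2 ^ k \<le> w" "w < 2 ^ Suc k" using ex_dyadic[OF w] .
    have y_pos: "y > 0" using y x0 by simp
    have "G y \<le> (2 ^ Suc k) powr \<beta> * G (2 ^ Suc k * y)" by (rule iter[OF y])
    also have "\<dots> \<le> (2 * w) powr \<beta> * G (y * w)"
    proof (rule mult_mono)
      show "(2 ^ Suc k) powr \<beta> \<le> (2 * w) powr \<beta>" using k(1) assms(2) by (intro powr_mono2) auto
      show "G (2 ^ Suc k * y) \<le> G (y * w)"
        using k(2) y_pos by (intro antimono) (simp add: mult.commute)
      show "0 \<le> G (2 ^ Suc k * y)" using pos[of "2 ^ Suc k * y"] y_pos by simp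
    qed simp
    finally show ?thesis .
  qed
  have G0: "G x0 > 0" "G x0 \<le> 1" using pos[OF x0] le_1 by auto
  show thesis
  proof (rule that[of "2 powr \<beta> / G x0" x0])
    fix x v :: real assume x: "x \<ge> x0" and v: "0 < v" "v \<le> 1"
    have x_pos: "x > 0" using x x0 by simp
    have eq: "(2 * (1 / v)) powr \<beta> = 2 powr \<beta> * v powr (- \<beta>)"
      using v by (simp add: powr_divide powr_minus field_simps)
    have nonneg: "0 \<le> 2 powr \<beta> * v powr (- \<beta>) * G x" using pos[OF x_pos] by simp
    have "G (x * v) * G x0 \<le> 2 powr \<beta> * v powr (- \<beta>) * G x"
    proof (cases "x * v \<ge> x0")
      case True
      then have "G (x * v) \<le> (2 * (1 / v)) powr \<beta> * G (x * v * (1 / v))" using v by (intro above) auto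
      then have "G (x * v) \<le> 2 powr \<beta> * v powr (- \<beta>) * G x" unfolding eq using v by simp
      moreover have "G (x * v) * G x0 \<le> G (x * v) * 1"
        using G0 pos[of "x * v"] x_pos v by (intro mult_left_mono) auto
      ultimately show ?thesis by simp
    next
      case False
      have "G (x * v) * G x0 \<le> 1 * G x0" using le_1 G0 by (intro mult_right_mono) auto
      also have "\<dots> \<le> (2 * (x / x0)) powr \<beta> * G (x0 * (x / x0))"
        using above[of x0 "x / x0"] x x0 by simp
      also have "\<dots> \<le> (2 * (1 / v)) powr \<beta> * G x"
        using False x0 v x_pos pos[OF x_pos] assms
        by (intro mult_mono powr_mono2) (auto simp: field_simps)
      finally show ?thesis unfolding eq .
    qed
    then show "G (x * v) \<le> 2 powr \<beta> / G x0 * v powr (- \<beta>) * G x"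
      using G0 by (simp add: field_simps)
  qed (use G0 x0 in auto)
qed

end

lemma regularly_varying_tailI:
  assumes L: "slowly_varying L" and G: "\<And>x. x > 0 \<Longrightarrow> G x = L x / x powr \<alpha>"
    and anti: "\<And>u v. u \<le> v \<Longrightarrow> G v \<le> G u" and le_1: "\<And>x. G x \<le> 1"
  shows "regularly_varying_tail G \<alpha>"
proof
  have Lpos: "\<forall>\<^sub>F x in at_top. L x > 0" using L by (simp add: slowly_varying_def)
  show "G x > 0" if "x > 0" for x
  proof -
    obtain y where y: "y \<ge> max x 1" "L y > 0"
      using eventually_happens[OF eventually_conj[OF Lpos eventually_ge_at_top[of "max x 1"]]] by auto
    then have "G y > 0" using G[of y] by simp
    then show ?thesis using anti[of x y] y(1) by linarith
  qed
  show "((\<lambda>x. G (c * x) / G x) \<longlongrightarrow> c powr (- \<alpha>)) at_top" if c: "c > 0" for c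
  proof (rule Lim_transform_eventually)
    have "((\<lambda>x. L (c * x) / L x) \<longlongrightarrow> 1) at_top" using L c by (simp add: slowly_varying_def)
    then show "((\<lambda>x. L (c * x) / L x * c powr (- \<alpha>)) \<longlongrightarrow> c powr (- \<alpha>)) at_top"
      using tendsto_mult[OF _ tendsto_const[of "c powr (- \<alpha>)"]] by fastforce
    show "\<forall>\<^sub>F x in at_top. L (c * x) / L x * c powr (- \<alpha>) = G (c * x) / G x"
      using eventually_gt_at_top[of 0] by eventually_elim (use c in \<open>auto simp: G powr_mult powr_minus field_simps\<close>)
  qed
qed (use assms in auto)

text \<open>The conjugate is an asymptotic inverse: since \<open>x * L x powr (- 1 / \<alpha>) = G x powr (- 1 / \<alpha>)\<close>,
  the defining limit says that \<open>G (y * Lsharp y) powr (- 1 / \<alpha>)\<close> is asymptotic to \<open>y\<close>.\<close>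

lemma de_Bruijn_quantile:
  assumes "regularly_varying_tail G \<alpha>" and \<alpha>: "\<alpha> > 0" and G: "\<And>x. x > 0 \<Longrightarrow> G x = L x / x powr \<alpha>"
    and conj: "de_Bruijn_conjugate (\<lambda>x. L x powr (- 1 / \<alpha>)) Lsharp"
  shows "((\<lambda>y. y powr \<alpha> * G (y * Lsharp y)) \<longlongrightarrow> 1) at_top"
    and "filterlim (\<lambda>y. y * Lsharp y) at_top at_top"
proof -
  interpret regularly_varying_tail G \<alpha> by fact
  have "\<forall>\<^sub>F y in at_top. Lsharp y > 0" using conj by (simp add: de_Bruijn_conjugate_def slowly_varying_def)
  moreover have "\<forall>\<^sub>F y in at_top. (y::real) > 0" by (rule eventually_gt_at_top)
  ultimately have ev: "\<forall>\<^sub>F y in at_top. y > 0 \<and> Lsharp y > 0" by eventually_elim simp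
  have lim: "((\<lambda>y. Lsharp y * L (y * Lsharp y) powr (- 1 / \<alpha>)) \<longlongrightarrow> 1) at_top"
    using conj by (simp add: de_Bruijn_conjugate_def)
  have "((\<lambda>y. (Lsharp y * L (y * Lsharp y) powr (- 1 / \<alpha>)) powr (- \<alpha>)) \<longlongrightarrow> 1 powr (- \<alpha>)) at_top"
    by (intro tendsto_powr lim tendsto_const) simp
  moreover have "\<forall>\<^sub>F y in at_top. (Lsharp y * L (y * Lsharp y) powr (- 1 / \<alpha>)) powr (- \<alpha>)
      = y powr \<alpha> * G (y * Lsharp y)"
    using ev
  proof eventually_elim
    case (elim y)
    let ?q = "y * Lsharp y"
    have q: "?q > 0" using elim by simp
    have "L ?q > 0" using pos[OF q] G[OF q] q by (simp add: zero_less_divide_iff)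
    then have "(Lsharp y * L ?q powr (- 1 / \<alpha>)) powr (- \<alpha>) = Lsharp y powr (- \<alpha>) * L ?q"
      using elim \<alpha> by (simp add: powr_mult powr_powr)
    also have "\<dots> = y powr \<alpha> * G ?q" using elim unfolding G[OF q] by (simp add: powr_mult powr_minus field_simps)
    finally show ?case .
  qed
  ultimately show lim1: "((\<lambda>y. y powr \<alpha> * G (y * Lsharp y)) \<longlongrightarrow> 1) at_top"
    by (auto intro: Lim_transform_eventually)
  have "((\<lambda>y::real. y powr (- \<alpha>)) \<longlongrightarrow> 0) at_top" using \<alpha> by (intro tendsto_neg_powr filterlim_ident) simp
  from tendsto_mult[OF this lim1]
  have "((\<lambda>y. y powr (- \<alpha>) * (y powr \<alpha> * G (y * Lsharp y))) \<longlongrightarrow> 0) at_top" by simp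
  moreover have "\<forall>\<^sub>F y in at_top. y powr (- \<alpha>) * (y powr \<alpha> * G (y * Lsharp y)) = G (y * Lsharp y)"
    using ev by eventually_elim (simp add: powr_minus field_simps)
  ultimately have lim0: "((\<lambda>y. G (y * Lsharp y)) \<longlongrightarrow> 0) at_top" by (auto intro: Lim_transform_eventually)
  show "filterlim (\<lambda>y. y * Lsharp y) at_top at_top"
    unfolding filterlim_at_top_dense
  proof
    fix B :: real
    have "G (max B 1) > 0" by (rule pos) simp
    from order_tendstoD(2)[OF lim0 this]
    show "\<forall>\<^sub>F y in at_top. B < y * Lsharp y"
    proof eventually_elim
      case (elim y)
      show ?case using antimono[of "y * Lsharp y" "max B 1"] elim by linarith
    qed
  qed
qed

section \<open>Convergence of the rescaled trimmed sums\<close>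

lemma limit_profile_integral:
  fixes \<alpha> :: real
  assumes "0 < \<alpha>" "\<alpha> < 1"
  shows "has_bochner_integral lborel (\<lambda>v. indicator {0<..} v * max 0 (v powr (- \<alpha>) - 1)) (\<alpha> / (1 - \<alpha>))"
proof (rule has_bochner_integral_nn_integral)
  have "((\<lambda>v. v powr (- \<alpha>) - 1) has_integral (1 powr (- \<alpha> + 1) / (- \<alpha> + 1) - 1)) {0..1}"
    using has_integral_powr_from_0[of "- \<alpha>" 1] has_integral_const_real[of "1::real" 0 1] assms
    by (intro has_integral_diff) auto
  moreover have "1 powr (- \<alpha> + 1) / (- \<alpha> + 1) - 1 = \<alpha> / (1 - \<alpha>)" using assms by (simp add: field_simps)
  ultimately have "((\<lambda>v. v powr (- \<alpha>) - 1) has_integral (\<alpha> / (1 - \<alpha>))) {0..1}" by simp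
  \<comment> \<open>At \<open>0\<close> the two integrands differ, because \<open>0 powr (- \<alpha>) = 0\<close>.\<close>
  then have "((\<lambda>v. max 0 (v powr (- \<alpha>) - 1)) has_integral (\<alpha> / (1 - \<alpha>))) {0..1}"
  proof (rule has_integral_spike_finite[of "{0}", rotated 2])
    fix v :: real assume "v \<in> {0..1} - {0}"
    then have "1 powr (- \<alpha>) \<le> v powr (- \<alpha>)" using assms by (intro powr_mono2') auto
    then show "max 0 (v powr (- \<alpha>) - 1) = v powr (- \<alpha>) - 1" by simp
  qed simp
  then have "(\<integral>\<^sup>+v. ennreal (max 0 (v powr (- \<alpha>) - 1)) * indicator {0..1} v \<partial>lborel) = ennreal (\<alpha> / (1 - \<alpha>))"
    by (intro nn_integral_has_integral_lebesgue') auto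
  moreover have "ennreal (indicator {0<..} v * max 0 (v powr (- \<alpha>) - 1))
      = ennreal (max 0 (v powr (- \<alpha>) - 1)) * indicator {0..1} v" for v :: real
  proof (cases "v > 1")
    case True
    then have "v powr (- \<alpha>) \<le> 1 powr (- \<alpha>)" using assms by (intro powr_mono2') auto
    then show ?thesis by simp
  qed (auto split: split_indicator simp: le_less ennreal_neg)
  ultimately show "(\<integral>\<^sup>+v. ennreal (indicator {0<..} v * max 0 (v powr (- \<alpha>) - 1)) \<partial>lborel) = ennreal (\<alpha> / (1 - \<alpha>))"
    by simp
qed (use assms in auto)

context observable begin

lemma exceed_count_eq_sum_if:
  "finite J \<Longrightarrow> real (exceed_count J u x) = (\<Sum>k\<in>J. if u < chi ((T ^^ k) x) then 1 else 0)"
  by (simp add: exceed_count_def sum.If_cases Int_def)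

text \<open>Joint measurability in the point and the level is what Tonelli's theorem requires.\<close>

lemma exceed_count_jointly_measurable [measurable]:
  assumes "finite J"
  shows "(\<lambda>z. real (exceed_count J (s * snd z) (fst z))) \<in> borel_measurable (M \<Otimes>\<^sub>M lborel)"
proof -
  have [measurable]: "(\<lambda>z. chi ((T ^^ k) (fst z))) \<in> borel_measurable (M \<Otimes>\<^sub>M lborel)" for k
    by (rule measurable_compose[OF measurable_fst orbit_measurable])
  show ?thesis unfolding exceed_count_eq_sum_if[OF assms] by measurable
qed

lemma orbit_nonneg:
  assumes "\<And>x. x \<in> space M \<Longrightarrow> 0 \<le> chi x" "x \<in> space M"
  shows "0 \<le> chi ((T ^^ k) x)"
  using assms measurable_space[OF funpow_measurable] by blast

lemma trimmed_sum_measurable: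
  assumes "\<And>x. x \<in> space M \<Longrightarrow> 0 \<le> chi x" "b \<ge> 1"
  shows "trimmed_sum T chi n b \<in> borel_measurable M"
proof -
  let ?I = "\<lambda>x. \<integral>v. indicator {0<..} v * max 0 (real (exceed_count {..<n} (1 * v) x) / real b - 1) \<partial>lborel"
  have "trimmed_sum T chi n b x = real b * ?I x" if "x \<in> space M" for x
    using has_bochner_integral_integral_eq[OF trimmed_sum_layer_cake[OF orbit_nonneg[OF assms(1) that], of 1 b n]] assms(2)
    by simp
  moreover have "(\<lambda>x. real b * ?I x) \<in> borel_measurable M"
  proof (intro borel_measurable_times borel_measurable_const lborel.borel_measurable_lebesgue_integral)
    have [measurable]: "(\<lambda>z. real (exceed_count {..<n} (1 * snd z) (fst z))) \<in> borel_measurable (M \<Otimes>\<^sub>M lborel)"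
      by (rule exceed_count_jointly_measurable) simp
    show "(\<lambda>(x, v). indicator {0<..} v * max 0 (real (exceed_count {..<n} (1 * v) x) / real b - 1)) \<in> borel_measurable (M \<Otimes>\<^sub>M lborel)"
      unfolding split_beta' by measurable
  qed
  ultimately show ?thesis by (subst measurable_cong) auto
qed

text \<open>Both the normalized sum and its limit are integrals over the level \<open>v\<close>, the latter by
  \<open>limit_profile_integral\<close>. The triangle inequality compares the integrands, and Tonelli's theorem then
  reduces the claim to means at a fixed level.\<close>

lemma trimmed_sum_distance_le:
  assumes nonneg: "\<And>x. x \<in> space M \<Longrightarrow> 0 \<le> chi x" and l: "l > 0" and b: "b \<ge> 1" and \<alpha>: "0 < \<alpha>" "\<alpha> < 1"
  shows "(\<integral>\<^sup>+x. ennreal \<bar>trimmed_sum T chi n b x / (real b * l) - \<alpha> / (1 - \<alpha>)\<bar> \<partial>M)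
    \<le> (\<integral>\<^sup>+v. ennreal (indicator {0<..} v *
        (\<integral>x. \<bar>max 0 (real (exceed_count {..<n} (l * v) x) / real b - 1) - max 0 (v powr (- \<alpha>) - 1)\<bar> \<partial>M)) \<partial>lborel)"
proof -
  define A where "A v x = max 0 (real (exceed_count {..<n} (l * v) x) / real b - 1)" for v x
  define c where "c v = max 0 (v powr (- \<alpha>) - 1)" for v :: real
  interpret P: pair_sigma_finite M lborel
    by (simp add: pair_sigma_finite_def sigma_finite_measure_axioms lborel.sigma_finite_measure_axioms)
  have [measurable]: "(\<lambda>z. A (snd z) (fst z)) \<in> borel_measurable (M \<Otimes>\<^sub>M lborel)" unfolding A_def by measurable
  have [measurable]: "c \<in> borel_measurable borel" unfolding c_def by measurable
  have "(\<integral>\<^sup>+x. ennreal \<bar>trimmed_sum T chi n b x / (real b * l) - \<alpha> / (1 - \<alpha>)\<bar> \<partial>M)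
     \<le> (\<integral>\<^sup>+x. \<integral>\<^sup>+v. ennreal (indicator {0<..} v * \<bar>A v x - c v\<bar>) \<partial>lborel \<partial>M)"
  proof (rule nn_integral_mono)
    fix x assume x: "x \<in> space M"
    have "has_bochner_integral lborel (\<lambda>v. indicator {0<..} v * A v x - indicator {0<..} v * c v)
        (trimmed_sum T chi n b x / (real b * l) - \<alpha> / (1 - \<alpha>))"
      unfolding A_def c_def
      by (intro has_bochner_integral_diff trimmed_sum_layer_cake limit_profile_integral \<alpha> l b orbit_nonneg nonneg x)
    from has_bochner_integral_norm_bound[OF this]
    have "ennreal \<bar>trimmed_sum T chi n b x / (real b * l) - \<alpha> / (1 - \<alpha>)\<bar>
       \<le> (\<integral>\<^sup>+v. ennreal \<bar>indicator {0<..} v * A v x - indicator {0<..} v * c v\<bar> \<partial>lborel)" by simp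
    also have "\<dots> = (\<integral>\<^sup>+v. ennreal (indicator {0<..} v * \<bar>A v x - c v\<bar>) \<partial>lborel)"
      by (intro nn_integral_cong) (auto split: split_indicator)
    finally show "ennreal \<bar>trimmed_sum T chi n b x / (real b * l) - \<alpha> / (1 - \<alpha>)\<bar> \<le> \<dots>" .
  qed
  also have "\<dots> = (\<integral>\<^sup>+v. \<integral>\<^sup>+x. ennreal (indicator {0<..} v * \<bar>A v x - c v\<bar>) \<partial>M \<partial>lborel)"
    by (rule P.Fubini'[symmetric]) (simp add: split_beta')
  also have "\<dots> = (\<integral>\<^sup>+v. ennreal (indicator {0<..} v * (\<integral>x. \<bar>A v x - c v\<bar> \<partial>M)) \<partial>lborel)"
  proof (rule nn_integral_cong)
    fix v :: real
    have "integrable M (\<lambda>x. indicator {0<..} v * \<bar>A v x - c v\<bar>)"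
      unfolding A_def using count_integrable[of "{..<n}" "l * v"] by simp
    then show "(\<integral>\<^sup>+x. ennreal (indicator {0<..} v * \<bar>A v x - c v\<bar>) \<partial>M) = ennreal (indicator {0<..} v * (\<integral>x. \<bar>A v x - c v\<bar> \<partial>M))"
      by (subst nn_integral_eq_integral) auto
  qed
  finally show ?thesis unfolding A_def c_def .
qed

text \<open>At a fixed level the count concentrates, and the rescaled tail converges to \<open>v powr (- \<alpha>)\<close>.
  An integrable majorant is the mean count for small \<open>v\<close> and, for large \<open>v\<close>, where the tail alone
  is not integrable, the excess over \<open>b\<close>, which decays like a power of the tail as high as desired.\<close>

lemma trimmed_sum_L1_limit:
  fixes b :: "nat \<Rightarrow> nat" and l :: "nat \<Rightarrow> real"
  assumes nonneg: "\<And>x. x \<in> space M \<Longrightarrow> 0 \<le> chi x"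
    and tail: "regularly_varying_tail Gbar \<alpha>" and \<alpha>: "0 < \<alpha>" "\<alpha> < 1"
    and C: "\<And>u m. u \<ge> 0 \<Longrightarrow> \<bar>\<Sum>k=1..m. prob (exceeds u 0 \<inter> exceeds u k) - (Gbar u)\<^sup>2\<bar> \<le> C * Gbar u"
    and psi: "psi_mixing_coeff M (\<lambda>n x. chi ((T ^^ (n - 1)) x)) r < 1" and r: "r \<ge> 1"
    and b: "filterlim b at_top sequentially" and l: "filterlim l at_top sequentially"
    and quantile: "(\<lambda>n. real n / real (b n) * Gbar (l n)) \<longlonglongrightarrow> 1"
  shows "(\<lambda>n. \<integral>\<^sup>+x. ennreal \<bar>trimmed_sum T chi n (b n) x / (real (b n) * l n) - \<alpha> / (1 - \<alpha>)\<bar> \<partial>M) \<longlonglongrightarrow> 0"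
proof -
  interpret regularly_varying_tail Gbar \<alpha> by (rule tail)
  define c where "c v = max 0 (v powr (- \<alpha>) - 1)" for v :: real
  define g where "g n v = real n / real (b n) * Gbar (l n * v)" for n v
  define U where "U n v = (\<integral>x. \<bar>max 0 (real (exceed_count {..<n} (l n * v) x) / real (b n) - 1) - c v\<bar> \<partial>M)" for n v
  have U_nonneg: "0 \<le> U n v" for n v unfolding U_def by simp
  have b_real: "filterlim (\<lambda>n. real (b n)) at_top sequentially"
    by (rule filterlim_compose[OF filterlim_real_sequentially b])
  have cnt: "integrable M (\<lambda>x. real (exceed_count {..<n} u x))" for n u by (rule count_integrable) simp
  have g_lim: "(\<lambda>n. g n v) \<longlonglongrightarrow> v powr (- \<alpha>)" if v: "v > 0" for v
  proof (rule Lim_transform_eventually)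
    have "(\<lambda>n. Gbar (v * l n) / Gbar (l n)) \<longlonglongrightarrow> v powr (- \<alpha>)"
      by (rule filterlim_compose[OF ratio[OF v] l])
    from tendsto_mult[OF quantile this]
    show "(\<lambda>n. real n / real (b n) * Gbar (l n) * (Gbar (v * l n) / Gbar (l n))) \<longlonglongrightarrow> v powr (- \<alpha>)" by simp
    have "\<forall>\<^sub>F n in sequentially. l n > 0" using l by (auto simp: filterlim_at_top_dense)
    then show "\<forall>\<^sub>F n in sequentially. real n / real (b n) * Gbar (l n) * (Gbar (v * l n) / Gbar (l n)) = g n v"
    proof eventually_elim
      case (elim n)
      then show ?case using pos[of "l n"] by (simp add: g_def mult.commute)
    qed
  qed
  have U_bound: "U n v \<le> (1 + (1 + 2 * C) * g n v) / (2 * sqrt (real (b n)))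
      + \<bar>max 0 (g n v - 1) - c v\<bar>" if v: "v > 0" and "l n > 0" "b n \<ge> 1" for n v
  proof -
    let ?N = "\<lambda>x. real (exceed_count {..<n} (l n * v) x)" and ?B = "real (b n)"
    have B: "?B > 0" using that by simp
    have "U n v \<le> (\<integral>x. \<bar>?N x - real n * Gbar (l n * v)\<bar> / ?B + \<bar>max 0 (g n v - 1) - c v\<bar> \<partial>M)"
      unfolding U_def
    proof (rule integral_mono)
      fix x
      have "\<bar>max 0 (?N x / ?B - 1) - max 0 (g n v - 1)\<bar> \<le> \<bar>?N x / ?B - g n v\<bar>" by (simp add: max_def abs_if)
      also have "\<dots> = \<bar>?N x - real n * Gbar (l n * v)\<bar> / ?B"
        using B by (simp add: g_def abs_divide flip: diff_divide_distrib)
      finally show "\<bar>max 0 (?N x / ?B - 1) - c v\<bar> \<le> \<bar>?N x - real n * Gbar (l n * v)\<bar> / ?B + \<bar>max 0 (g n v - 1) - c v\<bar>"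
        by linarith
    qed (use cnt in auto)
    also have "\<dots> = (\<integral>x. \<bar>?N x - real n * Gbar (l n * v)\<bar> \<partial>M) / ?B + \<bar>max 0 (g n v - 1) - c v\<bar>"
      using cnt by (simp add: prob_space)
    also have "(\<integral>x. \<bar>?N x - real n * Gbar (l n * v)\<bar> \<partial>M) \<le> (sqrt ?B + (1 + 2 * C) * (real n * Gbar (l n * v)) / sqrt ?B) / 2"
      using that B by (intro count_mean_deviation C) auto
    also have "\<dots> = (sqrt ?B + (1 + 2 * C) * (g n v * ?B) / sqrt ?B) / 2" using B by (simp add: g_def)
    also have "\<dots> / ?B = (1 + (1 + 2 * C) * g n v) / (2 * sqrt ?B)"
    proof -
      define s where "s = sqrt ?B"
      have "?B = s * s" "s > 0" using B by (auto simp: s_def)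
      then show ?thesis unfolding s_def[symmetric] by (simp add: field_simps)
    qed
    finally show ?thesis using B by (simp add: divide_right_mono)
  qed
  have U_lim: "(\<lambda>n. U n v) \<longlonglongrightarrow> 0" if v: "v > 0" for v
  proof (rule tendsto_sandwich[OF _ _ tendsto_const])
    show "\<forall>\<^sub>F n in sequentially. 0 \<le> U n v" by (simp add: U_nonneg)
    have "\<forall>\<^sub>F n in sequentially. l n > 0" using l by (auto simp: filterlim_at_top_dense)
    moreover have "\<forall>\<^sub>F n in sequentially. b n \<ge> 1" using b by (auto simp: filterlim_at_top)
    ultimately show "\<forall>\<^sub>F n in sequentially. U n v \<le> (1 + (1 + 2 * C) * g n v) / (2 * sqrt (real (b n)))
      + \<bar>max 0 (g n v - 1) - c v\<bar>" by eventually_elim (rule U_bound[OF v])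
    have "filterlim (\<lambda>n. 2 * sqrt (real (b n))) at_top sequentially"
      by (intro filterlim_tendsto_pos_mult_at_top[OF tendsto_const] filterlim_compose[OF sqrt_at_top b_real]) simp
    then have "(\<lambda>n. (1 + (1 + 2 * C) * g n v) / (2 * sqrt (real (b n)))) \<longlonglongrightarrow> 0"
      by (intro tendsto_divide_0[OF tendsto_add[OF tendsto_const tendsto_mult[OF tendsto_const g_lim[OF v]]]]
          filterlim_at_top_imp_at_infinity)
    moreover have "(\<lambda>n. \<bar>max 0 (g n v - 1) - c v\<bar>) \<longlonglongrightarrow> \<bar>max 0 (v powr (- \<alpha>) - 1) - c v\<bar>"
      by (intro tendsto_intros g_lim v)
    ultimately show "(\<lambda>n. (1 + (1 + 2 * C) * g n v) / (2 * sqrt (real (b n)))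
      + \<bar>max 0 (g n v - 1) - c v\<bar>) \<longlonglongrightarrow> 0"
      using tendsto_add[of _ 0 sequentially _ 0] by (simp add: c_def)
  qed
  \<comment> \<open>The majorant: \<open>\<beta> < 1\<close> makes \<open>v powr (- \<beta>)\<close> integrable at \<open>0\<close>, and \<open>p\<close> is so large that the \<open>p\<close>-th
    power of the Potter bound with exponent \<open>\<alpha> / 2\<close> decays at least like \<open>v powr (- 2)\<close>.\<close>
  define \<beta> where "\<beta> = (1 + \<alpha>) / 2"
  have \<beta>: "\<alpha> < \<beta>" "0 < \<beta>" "\<beta> < 1" using \<alpha> by (auto simp: \<beta>_def field_simps)
  define p where "p = nat \<lceil>4 / \<alpha>\<rceil>"
  have p: "real p * (\<alpha> / 2) \<ge> 2" "p \<ge> 1"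
  proof -
    have "4 / \<alpha> \<le> real p" unfolding p_def using \<alpha> by (simp add: of_nat_ceiling)
    then show "real p * (\<alpha> / 2) \<ge> 2" using \<alpha> by (simp add: field_simps)
    then show "p \<ge> 1" by (cases p) auto
  qed
  obtain C1 x1 where C1: "C1 > 0" "x1 > 0"
    "\<And>x v. x \<ge> x1 \<Longrightarrow> 0 < v \<Longrightarrow> v \<le> 1 \<Longrightarrow> Gbar (x * v) \<le> C1 * v powr (- \<beta>) * Gbar x"
    using potter_below[OF \<beta>(1,2)] by blast
  obtain C2 x2 where C2: "C2 > 0" "x2 > 0"
    "\<And>x v. x \<ge> x2 \<Longrightarrow> v \<ge> 1 \<Longrightarrow> Gbar (x * v) \<le> C2 * v powr (- (\<alpha> / 2)) * Gbar x"
    using potter_above[of "\<alpha> / 2"] \<alpha> by auto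
  define K1 where "K1 = 2 * C1 + 1"
  define K2 where "K2 = (2 * real p * real r * (2 * C2)) ^ p"
  define w where "w v = ennreal (K1 * v powr (- \<beta>)) * indicator {0..1} v
      + ennreal (K2 * v powr (- 2)) * indicator {1..} v" for v :: real
  have K: "K1 \<ge> 0" "K2 \<ge> 0" using C1 C2 by (auto simp: K1_def K2_def)
  have w_finite: "(\<integral>\<^sup>+v. w v \<partial>lborel) < \<infinity>"
  proof -
    have "(\<integral>\<^sup>+v. ennreal (K1 * v powr (- \<beta>)) * indicator {0..1} v \<partial>lborel)
        = ennreal (K1 * (1 powr (- \<beta> + 1) / (- \<beta> + 1)))"
      using K \<beta> by (intro nn_integral_has_integral_lebesgue' has_integral_mult_right has_integral_powr_from_0) auto
    moreover have "(\<integral>\<^sup>+v. ennreal (K2 * v powr (- 2)) * indicator {1..} v \<partial>lborel)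
        = ennreal (K2 * (- (1 powr (- 2 + 1)) / (- 2 + 1)))"
      using K by (intro nn_integral_has_integral_lebesgue' has_integral_mult_right has_integral_powr_to_inf) auto
    ultimately show ?thesis unfolding w_def by (subst nn_integral_add) auto
  qed
  have U_dominated: "ennreal (indicator {0<..} v * U n v) \<le> w v"
    if n: "l n \<ge> x1" "l n \<ge> x2" "b n \<ge> 1" "real (b n) \<ge> real r * real p"
      "real n / real (b n) * Gbar (l n) \<le> 2" for n v
  proof -
    let ?N = "\<lambda>x. real (exceed_count {..<n} (l n * v) x)" and ?B = "real (b n)"
    have B: "?B > 0" using n by simp
    consider "v \<le> 0" | "0 < v" "v \<le> 1" | "v > 1" by linarith
    then show ?thesis
    proof cases
      case 2
      have "1 powr (- \<beta>) \<le> v powr (- \<beta>)" "v powr (- \<alpha>) \<le> v powr (- \<beta>)"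
        using 2 \<beta> \<alpha> by (intro powr_mono2', auto intro!: powr_mono')
      have c: "0 \<le> c v" "c v \<le> v powr (- \<beta>)"
        using \<open>v powr (- \<alpha>) \<le> v powr (- \<beta>)\<close> by (auto simp: c_def)
      have "U n v \<le> (\<integral>x. ?N x / ?B + c v \<partial>M)"
        unfolding U_def
      proof (rule integral_mono)
        fix x
        have "0 \<le> ?N x / ?B" by simp
        then show "\<bar>max 0 (?N x / ?B - 1) - c v\<bar> \<le> ?N x / ?B + c v" using c(1) by linarith
      qed (use cnt in auto)
      also have "\<dots> = g n v + c v"
        using cnt by (simp add: prob_space expectation_count g_def)
      also have "g n v \<le> real n / ?B * (C1 * v powr (- \<beta>) * Gbar (l n))"
        unfolding g_def using C1(3)[OF n(1) 2] by (intro mult_left_mono) auto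
      also have "\<dots> = real n / ?B * Gbar (l n) * (C1 * v powr (- \<beta>))" by simp
      also have "\<dots> \<le> 2 * (C1 * v powr (- \<beta>))" using n(5) C1 by (intro mult_right_mono) auto
      finally have "U n v \<le> K1 * v powr (- \<beta>)" using c(2) by (simp add: K1_def algebra_simps)
      then have "ennreal (indicator {0<..} v * U n v) \<le> ennreal (K1 * v powr (- \<beta>)) * indicator {0..1} v"
        using 2 by (simp add: ennreal_leI)
      then show ?thesis unfolding w_def by (rule order_trans) simp
    next
      case 3
      have "v powr (- \<alpha>) \<le> 1 powr (- \<alpha>)" using 3 \<alpha> by (intro powr_mono2') auto
      then have c: "c v = 0" by (simp add: c_def)
      have "U n v = (\<integral>x. max 0 (?N x / ?B - 1) \<partial>M)" by (simp add: U_def c)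
      also have "\<dots> \<le> (2 * real p * real r * (real n * Gbar (l n * v) / ?B)) ^ p"
        by (rule expectation_excess_le[OF psi r p(2) n(4)])
      also have "\<dots> \<le> (2 * real p * real r * (2 * C2 * v powr (- (\<alpha> / 2)))) ^ p"
      proof (intro power_mono mult_left_mono)
        have "real n * Gbar (l n * v) / ?B \<le> real n / ?B * (C2 * v powr (- (\<alpha> / 2)) * Gbar (l n))"
          using C2(3)[OF n(2), of v] 3 mult_left_mono[of "Gbar (l n * v)" _ "real n / ?B"] by simp
        also have "\<dots> = real n / ?B * Gbar (l n) * (C2 * v powr (- (\<alpha> / 2)))" by simp
        also have "\<dots> \<le> 2 * (C2 * v powr (- (\<alpha> / 2)))" using n(5) C2 by (intro mult_right_mono) auto
        finally show "real n * Gbar (l n * v) / ?B \<le> 2 * C2 * v powr (- (\<alpha> / 2))" by simp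
      qed (use Gbar_nonneg in auto)
      also have "\<dots> = K2 * v powr (- (\<alpha> / 2) * real p)"
        using 3 by (simp add: K2_def power_mult_distrib powr_powr flip: powr_realpow)
      also have "\<dots> \<le> K2 * v powr (- 2)"
        using p(1) 3 K by (intro mult_left_mono powr_mono) (auto simp: mult.commute)
      finally have "ennreal (indicator {0<..} v * U n v) \<le> ennreal (K2 * v powr (- 2)) * indicator {1..} v"
        using 3 by (simp add: ennreal_leI)
      then show ?thesis unfolding w_def by (rule order_trans) simp
    qed simp
  qed
  have "\<forall>\<^sub>F n in sequentially. l n \<ge> x1 \<and> l n \<ge> x2 \<and> b n \<ge> 1 \<and> real (b n) \<ge> real r * real p
      \<and> real n / real (b n) * Gbar (l n) \<le> 2"
    using l b b_real order_tendstoD(2)[OF quantile, of 2]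
    by (intro eventually_conj) (auto simp: filterlim_at_top elim: eventually_mono)
  then obtain n0 where n0: "\<And>n. n \<ge> n0 \<Longrightarrow> l n \<ge> x1 \<and> l n \<ge> x2 \<and> b n \<ge> 1 \<and> real (b n) \<ge> real r * real p
      \<and> real n / real (b n) * Gbar (l n) \<le> 2" by (auto simp: eventually_sequentially)
  have U_meas: "(\<lambda>v. U n v) \<in> borel_measurable lborel" for n
    unfolding U_def
  proof (rule borel_measurable_lebesgue_integral)
    have [measurable]: "(\<lambda>z. real (exceed_count {..<n} (l n * fst z) (snd z))) \<in> borel_measurable (lborel \<Otimes>\<^sub>M M)"
      using measurable_compose[OF measurable_pair_swap' exceed_count_jointly_measurable[of "{..<n}" "l n"]] by (simp add: split_beta')
    show "(\<lambda>(v, x). \<bar>max 0 (real (exceed_count {..<n} (l n * v) x) / real (b n) - 1) - c v\<bar>) \<in> borel_measurable (lborel \<Otimes>\<^sub>M M)"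
      unfolding c_def split_beta' by measurable
  qed
  have "(\<lambda>k. \<integral>\<^sup>+v. ennreal (indicator {0<..} v * U (k + n0) v) \<partial>lborel) \<longlonglongrightarrow> (\<integral>\<^sup>+v. (0::ennreal) \<partial>(lborel :: real measure))"
  proof (rule nn_integral_dominated_convergence[where w = w])
    show "w \<in> borel_measurable lborel" unfolding w_def by measurable
    show "AE v in lborel. ennreal (indicator {0<..} v * U (k + n0) v) \<le> w v" for k
      using n0[of "k + n0"] by (intro AE_I2 U_dominated) simp_all
    show "AE v in lborel. (\<lambda>k. ennreal (indicator {0<..} v * U (k + n0) v)) \<longlonglongrightarrow> 0"
    proof (rule AE_I2)
      fix v :: real
      have "(\<lambda>k. indicator {0<..} v * U (k + n0) v) \<longlonglongrightarrow> 0"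
        using LIMSEQ_ignore_initial_segment[OF U_lim[of v], of n0] by (cases "v > 0") auto
      then show "(\<lambda>k. ennreal (indicator {0<..} v * U (k + n0) v)) \<longlonglongrightarrow> 0"
        using tendsto_ennrealI by fastforce
    qed
  qed (use U_meas w_finite in auto)
  then have upper: "(\<lambda>n. \<integral>\<^sup>+v. ennreal (indicator {0<..} v * U n v) \<partial>lborel) \<longlonglongrightarrow> 0"
    by (simp add: LIMSEQ_offset[of _ n0])
  show ?thesis
  proof (rule tendsto_sandwich[OF _ _ tendsto_const upper])
    show "\<forall>\<^sub>F n in sequentially. (\<integral>\<^sup>+x. ennreal \<bar>trimmed_sum T chi n (b n) x / (real (b n) * l n) - \<alpha> / (1 - \<alpha>)\<bar> \<partial>M)
       \<le> (\<integral>\<^sup>+v. ennreal (indicator {0<..} v * U n v) \<partial>lborel)"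
      unfolding eventually_sequentially
    proof (intro exI allI impI)
      fix n assume "n0 \<le> n"
      then show "(\<integral>\<^sup>+x. ennreal \<bar>trimmed_sum T chi n (b n) x / (real (b n) * l n) - \<alpha> / (1 - \<alpha>)\<bar> \<partial>M)
       \<le> (\<integral>\<^sup>+v. ennreal (indicator {0<..} v * U n v) \<partial>lborel)"
        using n0[of n] C1(2) unfolding U_def c_def
        by (intro trimmed_sum_distance_le nonneg \<alpha>) auto
    qed
  qed simp
qed

end

theorem theorem1p5:
  fixes M :: "'a measure" and T :: "'a \<Rightarrow> 'a"
    and F :: "('a \<Rightarrow> complex) set" and nrm :: "('a \<Rightarrow> complex) \<Rightarrow> real"
    and chi :: "'a \<Rightarrow> real" and L Lsharp :: "real \<Rightarrow> real" and \<alpha> :: real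
    and b :: "nat \<Rightarrow> nat" and r :: nat and d :: "nat \<Rightarrow> real"
  assumes "property_D M T F nrm chi"
    and "0 < \<alpha>" and "\<alpha> < 1"
    and "slowly_varying L"
    and "\<And>x. x > 0 \<Longrightarrow> measure M {\<omega> \<in> space M. chi \<omega> > x} = L x / x powr \<alpha>"
    and "\<And>n. n \<ge> 1 \<Longrightarrow> b n \<ge> 1"
    and "filterlim b at_top sequentially"
    and "(\<lambda>n. real (b n)) \<in> o(\<lambda>n. real n)"
    and "r \<ge> 1"
    and "psi_mixing_coeff M (\<lambda>n x. chi ((T ^^ (n - 1)) x)) r < 1"
    and "de_Bruijn_conjugate (\<lambda>x. L x powr (- 1 / \<alpha>)) Lsharp"
    and "\<And>n. n \<ge> 1 \<Longrightarrow> d n = \<alpha> / (1 - \<alpha>) * real n powr (1 / \<alpha>) * real (b n) powr (1 - 1 / \<alpha>)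
                 * Lsharp ((real n / real (b n)) powr (1 / \<alpha>))"
  shows "(\<lambda>n. \<integral>\<^sup>+x. ennreal \<bar>trimmed_sum T chi n (b n) x / d n - 1\<bar> \<partial>M) \<longlonglongrightarrow> 0"
proof -
  have D: "property_C M T F nrm" "chi \<in> borel_measurable M" "\<And>x. x \<in> space M \<Longrightarrow> 0 \<le> chi x"
    using assms(1) by (auto simp: property_D_def)
  obtain K where K: "K > 0" "\<And>u. u \<ge> 0 \<Longrightarrow> (\<lambda>x. complex_of_real (indicator {y. chi y > u} x)) \<in> F"
    "\<And>u. u \<ge> 0 \<Longrightarrow> nrm (\<lambda>x. complex_of_real (indicator {y. chi y > u} x)) \<le> K"
    using assms(1) unfolding property_D_def by blast
  interpret spectral_gap_system M T F nrm by unfold_locales (rule D(1))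
  interpret observable M T chi by unfold_locales (rule D(2))
  note \<alpha> = assms(2,3)

  \<comment> \<open>The indicators of \<open>{chi > u}\<close> have norm at most \<open>K\<close>, so that their summed correlations are bounded by
    a multiple of \<open>Gbar u\<close> that is independent of \<open>u\<close>.\<close>
  obtain C0 where C0: "C0 \<ge> 0" "\<forall>f\<in>F. \<forall>g\<in>borel_measurable M. \<forall>B m. (AE x in M. cmod (g x) \<le> B) \<longrightarrow>
       cmod (\<Sum>k=1..m. (\<integral>x. f x * g ((T ^^ k) x) \<partial>M) - (\<integral>x. f x \<partial>M) * (\<integral>x. g x \<partial>M))
         \<le> C0 * nrm f * (\<integral>x. cmod (g x) \<partial>M)" using summed_correlations by blast
  have corr: "\<bar>\<Sum>k=1..m. prob (exceeds u 0 \<inter> exceeds u k) - (Gbar u)\<^sup>2\<bar> \<le> C0 * K * Gbar u" if u: "u \<ge> 0" for u m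
  proof -
    let ?f = "\<lambda>x. complex_of_real (indicator {y. chi y > u} x)"
    have f [measurable]: "?f \<in> borel_measurable M" by measurable
    have 1: "(\<integral>x. ?f x * ?f ((T ^^ k) x) \<partial>M) = complex_of_real (prob (exceeds u 0 \<inter> exceeds u k))" for k
    proof -
      have "(\<integral>x. ?f x * ?f ((T ^^ k) x) \<partial>M) = (\<integral>x. complex_of_real (indicator (exceeds u 0 \<inter> exceeds u k) x) \<partial>M)"
        by (intro Bochner_Integration.integral_cong refl) (auto simp: exceeds_def indicator_def)
      then show ?thesis by (simp add: exceeds_def Int_absorb2 Collect_conj_eq[symmetric])
    qed
    have 2: "(\<integral>x. ?f x \<partial>M) = complex_of_real (Gbar u)"
    proof -
      have "(\<integral>x. ?f x \<partial>M) = (\<integral>x. complex_of_real (indicator (exceeds u 0) x) \<partial>M)"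
        by (intro Bochner_Integration.integral_cong refl) (auto simp: exceeds_def indicator_def)
      then show ?thesis using prob_exceeds[of u 0] sets.sets_into_space[OF exceeds_sets[of u 0]] by (simp add: Int_absorb2)
    qed
    have 3: "(\<integral>x. cmod (?f x) \<partial>M) = Gbar u"
    proof -
      have "complex_of_real (\<integral>x. cmod (?f x) \<partial>M) = (\<integral>x. ?f x \<partial>M)" by simp
      then show ?thesis unfolding 2 by (simp only: of_real_eq_iff)
    qed
    have "cmod (\<Sum>k=1..m. (\<integral>x. ?f x * ?f ((T ^^ k) x) \<partial>M) - (\<integral>x. ?f x \<partial>M) * (\<integral>x. ?f x \<partial>M))
         \<le> C0 * nrm ?f * (\<integral>x. cmod (?f x) \<partial>M)"
      by (rule C0(2)[rule_format, OF K(2)[OF u] f, of 1]) (auto simp: indicator_def)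
    also have "(\<Sum>k=1..m. (\<integral>x. ?f x * ?f ((T ^^ k) x) \<partial>M) - (\<integral>x. ?f x \<partial>M) * (\<integral>x. ?f x \<partial>M))
       = complex_of_real (\<Sum>k=1..m. prob (exceeds u 0 \<inter> exceeds u k) - (Gbar u)\<^sup>2)"
      unfolding 1 2 by (simp add: power2_eq_square)
    also have "cmod \<dots> = \<bar>\<Sum>k=1..m. prob (exceeds u 0 \<inter> exceeds u k) - (Gbar u)\<^sup>2\<bar>" by (rule norm_of_real)
    also have "C0 * nrm ?f * (\<integral>x. cmod (?f x) \<partial>M) \<le> C0 * K * Gbar u"
      unfolding 3 by (intro mult_right_mono mult_left_mono K(3) u C0(1) Gbar_nonneg)
    finally show ?thesis .
  qed

  have Gbar: "Gbar x = L x / x powr \<alpha>" if "x > 0" for x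
    using assms(5)[OF that] by (simp add: Gbar_def)
  have tail: "regularly_varying_tail Gbar \<alpha>"
    by (rule regularly_varying_tailI[OF assms(4) Gbar Gbar_antimono Gbar_le_1])
  define y where "y n = (real n / real (b n)) powr (1 / \<alpha>)" for n
  define l where "l n = y n * Lsharp (y n)" for n
  have ratio_top: "filterlim (\<lambda>n. real n / real (b n)) at_top sequentially"
  proof -
    have "(\<lambda>n. real (b n) / real n) \<longlonglongrightarrow> 0" using assms(8) by (rule smalloD_tendsto)
    moreover have "\<forall>\<^sub>F n in sequentially. real (b n) / real n > 0"
      using eventually_ge_at_top[of 1] by eventually_elim (use assms(6) in force)
    ultimately have "filterlim (\<lambda>n. inverse (real (b n) / real n)) at_top sequentially"
      by (rule filterlim_inverse_at_top)
    then show ?thesis by simp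
  qed
  have y: "filterlim y at_top sequentially"
  proof (rule filterlim_at_top_mono[OF ratio_top])
    have "\<forall>\<^sub>F n in sequentially. real n / real (b n) \<ge> 1"
      using ratio_top by (auto simp: filterlim_at_top)
    then show "\<forall>\<^sub>F n in sequentially. real n / real (b n) \<le> y n"
    proof eventually_elim
      case (elim n)
      have "(real n / real (b n)) powr 1 \<le> (real n / real (b n)) powr (1 / \<alpha>)"
        using elim \<alpha> by (intro powr_mono) auto
      then show ?case using elim by (simp add: y_def)
    qed
  qed
  note quant = de_Bruijn_quantile[OF tail \<alpha>(1) Gbar assms(11)]
  have l: "filterlim l at_top sequentially"
    unfolding l_def by (rule filterlim_compose[OF quant(2) y])
  have "(\<lambda>n. y n powr \<alpha> * Gbar (l n)) \<longlonglongrightarrow> 1"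
    unfolding l_def by (rule filterlim_compose[OF quant(1) y])
  moreover have "y n powr \<alpha> = real n / real (b n)" for n
    using \<alpha> by (cases "real n / real (b n) = 0") (auto simp: y_def powr_powr)
  ultimately have quantile: "(\<lambda>n. real n / real (b n) * Gbar (l n)) \<longlonglongrightarrow> 1" by simp

  define \<kappa> where "\<kappa> = \<alpha> / (1 - \<alpha>)"
  have \<kappa>: "\<kappa> > 0" using \<alpha> by (simp add: \<kappa>_def)
  have d: "d n = \<kappa> * (real (b n) * l n)" if n: "n \<ge> 1" for n
  proof -
    have B: "real (b n) > 0" using assms(6)[OF n] by simp
    have "real n powr (1 / \<alpha>) * real (b n) powr (1 - 1 / \<alpha>) = real (b n) * y n"
      using B by (simp add: y_def powr_diff powr_divide)
    then show ?thesis unfolding assms(12)[OF n] \<kappa>_def l_def y_def[symmetric] by simp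
  qed
  have "(\<lambda>n. ennreal (1 / \<kappa>) * (\<integral>\<^sup>+x. ennreal \<bar>trimmed_sum T chi n (b n) x / (real (b n) * l n) - \<kappa>\<bar> \<partial>M))
      \<longlonglongrightarrow> ennreal (1 / \<kappa>) * 0"
    unfolding \<kappa>_def
    by (intro ennreal_tendsto_cmult trimmed_sum_L1_limit[where r = r, OF D(3) tail \<alpha> corr] assms(7,9,10) l quantile) auto
  moreover have "\<forall>\<^sub>F n in sequentially. ennreal (1 / \<kappa>) * (\<integral>\<^sup>+x. ennreal \<bar>trimmed_sum T chi n (b n) x / (real (b n) * l n) - \<kappa>\<bar> \<partial>M)
     = (\<integral>\<^sup>+x. ennreal \<bar>trimmed_sum T chi n (b n) x / d n - 1\<bar> \<partial>M)"
    using eventually_ge_at_top[of 1]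
  proof eventually_elim
    case (elim n)
    have [measurable]: "trimmed_sum T chi n (b n) \<in> borel_measurable M"
      by (rule trimmed_sum_measurable[OF D(3) assms(6)[OF elim]])
    show ?case
    proof (subst nn_integral_cmult[symmetric])
      show "(\<lambda>x. ennreal \<bar>trimmed_sum T chi n (b n) x / (real (b n) * l n) - \<kappa>\<bar>) \<in> borel_measurable M"
        by measurable
      have "1 / \<kappa> * \<bar>s / (real (b n) * l n) - \<kappa>\<bar> = \<bar>s / d n - 1\<bar>" for s
      proof -
        have "s / d n - 1 = (s / (real (b n) * l n) - \<kappa>) / \<kappa>"
          using \<kappa> unfolding d[OF elim] by (simp add: diff_divide_distrib mult.commute)
        then show ?thesis using \<kappa> by (simp add: abs_divide)
      qed
      then show "(\<integral>\<^sup>+x. ennreal (1 / \<kappa>) * ennreal \<bar>trimmed_sum T chi n (b n) x / (real (b n) * l n) - \<kappa>\<bar> \<partial>M)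
        = (\<integral>\<^sup>+x. ennreal \<bar>trimmed_sum T chi n (b n) x / d n - 1\<bar> \<partial>M)"
        using \<kappa> by (simp flip: ennreal_mult)
    qed
  qed
  ultimately show ?thesis by (auto intro: Lim_transform_eventually)
qed

end
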